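(* The natural short exact sequence $$0\to \Lambda^3(A)\to H_3(A)\to \Omega_2(A)\to 0$$ of functors of the abelian group $A$ does not split functorially.
   Context: For an abelian group $A$, $H_3(A)=H_3(K(A,1);\mathbb{Z})$ is its third integral group homology, $\Lambda^3$ is the third exterior power, and $\Omega_2$ is the quadratic functor of Eilenberg-MacLane, which is the first derived functor (in the sense of Dold-Puppe) of the exterior square: $\Omega_2(A)=L_1\Lambda^2(A)=\pi_1(\Lambda^2(K P_* ))$, where $P_*\to A$ is a projective resolution and $K$ is the Dold-Kan functor from chain complexes to simplicial abelian groups. The map $\Lambda^3(A)\to H_3(A)$ is induced by the Pontryagin product on $H_*(A)$ and the identification $A=H_1(A)$; it is known that it is injective and that its cokernel is naturally isomorphic to $\Omega_2(A)$, which gives the sequence above. All functors are regarded as functors from the category $\mathsf{Ab}$ of finitely generated abelian groups to itself; to split functorially means to split as a sequence of such functors. *)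

theory Defs
  imports "HOL-Algebra.Free_Abelian_Groups" "HOL-Library.Infinite_Typeclass"
begin

section \<open>Functors on finitely generated abelian groups\<close>

definition fg_ab :: "'a monoid \<Rightarrow> bool" where
  "fg_ab A \<longleftrightarrow> comm_group A \<and> (\<exists>S. finite S \<and> S \<subseteq> carrier A \<and> generate A S = carrier A)"

text \<open>A functor from the groups \<^term>\<open>A\<close> with \<^term>\<open>fg_ab A\<close> to groups. The source and the target of
  a homomorphism are arguments of the action on morphisms, because a function does not determine
  them. As soon as \<^typ>\<open>'a\<close> is infinite, every finitely generated abelian group is isomorphic to
  one with elements in \<^typ>\<open>'a\<close>.\<close>

record ('a, 'b) ab_functor =
  on_ob :: "'a monoid \<Rightarrow> 'b monoid"
  on_hom :: "'a monoid \<Rightarrow> 'a monoid \<Rightarrow> ('a \<Rightarrow> 'a) \<Rightarrow> 'b \<Rightarrow> 'b"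

definition nat_trans ::
  "('a, 'b) ab_functor \<Rightarrow> ('a, 'c) ab_functor \<Rightarrow> ('a monoid \<Rightarrow> 'b \<Rightarrow> 'c) \<Rightarrow> bool" where
  "nat_trans F G \<eta> \<longleftrightarrow>
     (\<forall>A. fg_ab A \<longrightarrow> \<eta> A \<in> hom (on_ob F A) (on_ob G A)) \<and>
     (\<forall>A B f. fg_ab A \<longrightarrow> fg_ab B \<longrightarrow> f \<in> hom A B \<longrightarrow>
        (\<forall>x \<in> carrier (on_ob F A). \<eta> B (on_hom F A B f x) = on_hom G A B f (\<eta> A x)))"

definition short_exact ::
  "('a, 'b) ab_functor \<Rightarrow> ('a monoid \<Rightarrow> 'b \<Rightarrow> 'c) \<Rightarrow> ('a, 'c) ab_functor \<Rightarrow>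
   ('a monoid \<Rightarrow> 'c \<Rightarrow> 'd) \<Rightarrow> ('a, 'd) ab_functor \<Rightarrow> bool" where
  "short_exact F i G p H \<longleftrightarrow> nat_trans F G i \<and> nat_trans G H p \<and>
     (\<forall>A. fg_ab A \<longrightarrow>
        inj_on (i A) (carrier (on_ob F A)) \<and>
        i A ` carrier (on_ob F A) = kernel (on_ob G A) (on_ob H A) (p A) \<and>
        p A ` carrier (on_ob G A) = carrier (on_ob H A))"

definition natural_retraction ::
  "('a, 'b) ab_functor \<Rightarrow> ('a monoid \<Rightarrow> 'b \<Rightarrow> 'c) \<Rightarrow> ('a, 'c) ab_functor \<Rightarrow>
   ('a monoid \<Rightarrow> 'c \<Rightarrow> 'b) \<Rightarrow> bool" where
  "natural_retraction F i G r \<longleftrightarrow> nat_trans G F r \<and>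
     (\<forall>A. fg_ab A \<longrightarrow> (\<forall>x \<in> carrier (on_ob F A). r A (i A x) = x))"

definition natural_section ::
  "('a, 'c) ab_functor \<Rightarrow> ('a monoid \<Rightarrow> 'c \<Rightarrow> 'd) \<Rightarrow> ('a, 'd) ab_functor \<Rightarrow>
   ('a monoid \<Rightarrow> 'd \<Rightarrow> 'c) \<Rightarrow> bool" where
  "natural_section G p H s \<longleftrightarrow> nat_trans H G s \<and>
     (\<forall>A. fg_ab A \<longrightarrow> (\<forall>z \<in> carrier (on_ob H A). p A (s A z) = z))"

text \<open>If \<^term>\<open>h\<close> is a homomorphism \<open>G \<rightarrow> G'\<close> that maps a subgroup \<open>N\<close> of \<open>G\<close> into the subgroup
  \<^term>\<open>N'\<close> of \<^term>\<open>G'\<close>, this is the induced homomorphism \<open>G Mod N \<rightarrow> G' Mod N'\<close>: all the cosets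
  in the union are equal.\<close>

definition quot_map :: "'c monoid \<Rightarrow> 'c set \<Rightarrow> ('b \<Rightarrow> 'c) \<Rightarrow> 'b set \<Rightarrow> 'c set" where
  "quot_map G' N' h X = (\<Union>x\<in>X. r_coset G' N' (h x))"

abbreviation frag_map :: "('a \<Rightarrow> 'b) \<Rightarrow> ('a \<Rightarrow>\<^sub>0 int) \<Rightarrow> ('b \<Rightarrow>\<^sub>0 int)" where
  "frag_map f \<equiv> frag_extend (\<lambda>x. frag_of (f x))"


section \<open>Exterior powers\<close>

definition tuples :: "nat \<Rightarrow> 'a monoid \<Rightarrow> 'a list set" where
  "tuples n A = {xs. length xs = n \<and> set xs \<subseteq> carrier A}"

definition ext_relations :: "nat \<Rightarrow> 'a monoid \<Rightarrow> ('a list \<Rightarrow>\<^sub>0 int) set" where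
  "ext_relations n A =
     {frag_of (xs[i := a \<otimes>\<^bsub>A\<^esub> b]) - frag_of (xs[i := a]) - frag_of (xs[i := b]) | xs i a b.
        xs \<in> tuples n A \<and> i < n \<and> a \<in> carrier A \<and> b \<in> carrier A} \<union>
     {frag_of xs | xs. xs \<in> tuples n A \<and> (\<exists>i j. i < j \<and> j < n \<and> xs ! i = xs ! j)}"

definition ext_null :: "nat \<Rightarrow> 'a monoid \<Rightarrow> ('a list \<Rightarrow>\<^sub>0 int) set" where
  "ext_null n A = generate (free_Abelian_group (tuples n A)) (ext_relations n A)"

definition ext_power :: "nat \<Rightarrow> 'a monoid \<Rightarrow> ('a list \<Rightarrow>\<^sub>0 int) set monoid" where
  "ext_power n A = free_Abelian_group (tuples n A) Mod ext_null n A"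

definition ext_power_map ::
  "nat \<Rightarrow> 'b monoid \<Rightarrow> ('a \<Rightarrow> 'b) \<Rightarrow> ('a list \<Rightarrow>\<^sub>0 int) set \<Rightarrow> ('b list \<Rightarrow>\<^sub>0 int) set" where
  "ext_power_map n B f =
     quot_map (free_Abelian_group (tuples n B)) (ext_null n B) (frag_map (map f))"

definition Ext_functor :: "nat \<Rightarrow> ('a, ('a list \<Rightarrow>\<^sub>0 int) set) ab_functor" where
  "Ext_functor n = \<lparr>on_ob = ext_power n, on_hom = (\<lambda>A B f. ext_power_map n B f)\<rparr>"


section \<open>Integral homology of an abelian group\<close>

text \<open>The (unnormalized, inhomogeneous) bar complex: the chain complex of the simplicial set \<open>BA\<close>,
  which is a model of \<open>K(A,1)\<close>. The simplex \<open>[a\<^sub>1|...|a\<^sub>n]\<close> is a list.\<close>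

definition bar_face :: "'a monoid \<Rightarrow> nat \<Rightarrow> 'a list \<Rightarrow> 'a list" where
  "bar_face A i xs =
     (if i = 0 then tl xs
      else if i = length xs then butlast xs
      else take (i - 1) xs @ (xs ! (i - 1) \<otimes>\<^bsub>A\<^esub> xs ! i) # drop (i + 1) xs)"

definition bar_boundary :: "'a monoid \<Rightarrow> ('a list \<Rightarrow>\<^sub>0 int) \<Rightarrow> ('a list \<Rightarrow>\<^sub>0 int)" where
  "bar_boundary A = frag_extend (\<lambda>xs. if xs = [] then 0
     else (\<Sum>i\<le>length xs. frag_cmul ((-1) ^ i) (frag_of (bar_face A i xs))))"

definition bar_cycles :: "nat \<Rightarrow> 'a monoid \<Rightarrow> ('a list \<Rightarrow>\<^sub>0 int) monoid" where
  "bar_cycles n A = (free_Abelian_group (tuples n A))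
     \<lparr>carrier := {c \<in> carrier (free_Abelian_group (tuples n A)). bar_boundary A c = 0}\<rparr>"

definition bar_boundaries :: "nat \<Rightarrow> 'a monoid \<Rightarrow> ('a list \<Rightarrow>\<^sub>0 int) set" where
  "bar_boundaries n A = bar_boundary A ` carrier (free_Abelian_group (tuples (Suc n) A))"

definition group_homology :: "nat \<Rightarrow> 'a monoid \<Rightarrow> ('a list \<Rightarrow>\<^sub>0 int) set monoid" where
  "group_homology n A = bar_cycles n A Mod bar_boundaries n A"

definition group_homology_map ::
  "nat \<Rightarrow> 'b monoid \<Rightarrow> ('a \<Rightarrow> 'b) \<Rightarrow> ('a list \<Rightarrow>\<^sub>0 int) set \<Rightarrow> ('b list \<Rightarrow>\<^sub>0 int) set" where
  "group_homology_map n B f =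
     quot_map (bar_cycles n B) (bar_boundaries n B) (frag_map (map f))"

definition Homology_functor :: "nat \<Rightarrow> ('a, ('a list \<Rightarrow>\<^sub>0 int) set) ab_functor" where
  "Homology_functor n = \<lparr>on_ob = group_homology n, on_hom = (\<lambda>A B f. group_homology_map n B f)\<rparr>"

text \<open>The Pontryagin product is induced by the addition \<open>A \<times> A \<rightarrow> A\<close>. On bar chains it is the
  Eilenberg-Zilber shuffle map \<open>C\<^sub>*(BA) \<otimes> C\<^sub>*(BA) \<rightarrow> C\<^sub>*(B(A \<times> A))\<close> followed by the map induced
  by the addition, i.e. the signed sum of all interleavings: the degeneracies insert neutral
  elements, which the addition absorbs.\<close>

fun shuffle_lists :: "'a list \<Rightarrow> 'a list \<Rightarrow> ('a list \<Rightarrow>\<^sub>0 int)" where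
  "shuffle_lists [] ys = frag_of ys"
| "shuffle_lists (x # xs) [] = frag_of (x # xs)"
| "shuffle_lists (x # xs) (y # ys) =
     frag_map (Cons x) (shuffle_lists xs (y # ys)) +
     frag_cmul ((-1) ^ length (x # xs)) (frag_map (Cons y) (shuffle_lists (x # xs) ys))"

definition pontryagin ::
  "('a list \<Rightarrow>\<^sub>0 int) \<Rightarrow> ('a list \<Rightarrow>\<^sub>0 int) \<Rightarrow> ('a list \<Rightarrow>\<^sub>0 int)" where
  "pontryagin c d = frag_extend (\<lambda>xs. frag_extend (\<lambda>ys. shuffle_lists xs ys) d) c"

text \<open>The map \<open>\<Lambda>\<^sup>n(A) \<rightarrow> H\<^sub>n(A)\<close>, \<open>a\<^sub>1 \<and> ... \<and> a\<^sub>n \<mapsto> [a\<^sub>1] \<cdot> ... \<cdot> [a\<^sub>n]\<close>, where \<open>[a] \<in> H\<^sub>1(A)\<close> is the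
  class of the cycle \<^term>\<open>frag_of [a]\<close> corresponding to \<open>a\<close> under \<open>A = H\<^sub>1(A)\<close>, and
  \<^term>\<open>frag_of []\<close> is the unit of the product.\<close>

definition ext_to_homology ::
  "nat \<Rightarrow> 'a monoid \<Rightarrow> ('a list \<Rightarrow>\<^sub>0 int) set \<Rightarrow> ('a list \<Rightarrow>\<^sub>0 int) set" where
  "ext_to_homology n A = quot_map (bar_cycles n A) (bar_boundaries n A)
     (frag_extend (\<lambda>xs. foldr (\<lambda>x c. pontryagin (frag_of [x]) c) xs (frag_of [])))"


section \<open>The functor \<open>\<Omega>\<^sub>2 = L\<^sub>1\<Lambda>\<^sup>2\<close>\<close>

text \<open>The functorial projective resolution \<open>0 \<rightarrow> ker \<epsilon> \<rightarrow> \<int>[A] \<rightarrow> A \<rightarrow> 0\<close>, with \<open>\<epsilon>\<close> the evaluation of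
  formal sums of elements of \<open>A\<close> in \<open>A\<close>; \<open>ker \<epsilon>\<close> is free as a subgroup of a free abelian group.
  The chain complex is \<open>res A 0 = \<int>[A]\<close>, \<open>res A 1 = ker \<epsilon>\<close>, with the inclusion as differential.\<close>

definition evaluation :: "'a monoid \<Rightarrow> ('a \<Rightarrow>\<^sub>0 int) \<Rightarrow> 'a" where
  "evaluation A c =
     finprod A (\<lambda>a. a [^]\<^bsub>A\<^esub> Poly_Mapping.lookup c a) (Poly_Mapping.keys c)"

definition res :: "'a monoid \<Rightarrow> nat \<Rightarrow> ('a \<Rightarrow>\<^sub>0 int) set" where
  "res A n =
     (if n = 0 then carrier (free_Abelian_group (carrier A))
      else if n = 1 then kernel (free_Abelian_group (carrier A)) A (evaluation A)
      else {0})"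

definition res_diff :: "nat \<Rightarrow> ('a \<Rightarrow>\<^sub>0 int) \<Rightarrow> ('a \<Rightarrow>\<^sub>0 int)" where
  "res_diff n x = (if n = 1 then x else 0)"

text \<open>The Dold-Kan functor. For a chain complex with groups \<^term>\<open>C k\<close> and differentials
  \<open>D k : C k \<rightarrow> C (k - 1)\<close>, the group of \<open>n\<close>-simplices of \<open>K C\<close> is the group of chain maps from the
  normalized chain complex of the simplex \<open>\<Delta>\<^sup>n\<close> to \<open>C\<close>. Degree \<open>k\<close> of the former is free on the
  subsets \<open>S \<subseteq> {0..n}\<close> with \<open>k + 1\<close> elements, so a chain map is a family \<open>c S \<in> C k\<close> (extended by
  \<open>0\<close> to all other sets); in the compatibility with the differentials, the sign of the face
  \<open>S - {s}\<close> is given by the position of \<open>s\<close> in \<open>S\<close>. A simplicial operator \<open>\<theta>\<close> sends \<open>c\<close> to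
  \<open>S \<mapsto> c (\<theta> ` S)\<close> if \<open>\<theta>\<close> is injective, in particular if it is a coface map.\<close>

definition dold_kan ::
  "(nat \<Rightarrow> 'b::ab_group_add set) \<Rightarrow> (nat \<Rightarrow> 'b \<Rightarrow> 'b) \<Rightarrow> nat \<Rightarrow> (nat set \<Rightarrow> 'b) monoid" where
  "dold_kan C D n =
     \<lparr>carrier = {c.
        (\<forall>S. S \<subseteq> {..n} \<and> S \<noteq> {} \<longrightarrow> c S \<in> C (card S - 1)) \<and>
        (\<forall>S. \<not> (S \<subseteq> {..n} \<and> S \<noteq> {}) \<longrightarrow> c S = 0) \<and>
        (\<forall>S. S \<subseteq> {..n} \<and> card S \<ge> 2 \<longrightarrow>
           D (card S - 1) (c S) =
             (\<Sum>s\<in>S. if even (card {t \<in> S. t < s}) then c (S - {s}) else - c (S - {s})))},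
      monoid.mult = (\<lambda>c c' S. c S + c' S), one = (\<lambda>S. 0)\<rparr>"

definition coface :: "nat \<Rightarrow> nat \<Rightarrow> nat" where
  "coface i j = (if j < i then j else j + 1)"

definition dold_kan_face :: "nat \<Rightarrow> (nat set \<Rightarrow> 'b) \<Rightarrow> (nat set \<Rightarrow> 'b)" where
  "dold_kan_face i c = (\<lambda>S. c (coface i ` S))"

text \<open>Homotopy groups of a simplicial abelian group with face maps \<open>d n i : X n \<rightarrow> X (n - 1)\<close>:
  the \<open>n\<close>-simplices all of whose faces vanish, modulo the last faces of the \<open>(n + 1)\<close>-simplices
  all of whose other faces vanish.\<close>

definition spheres :: "(nat \<Rightarrow> 'b monoid) \<Rightarrow> (nat \<Rightarrow> nat \<Rightarrow> 'b \<Rightarrow> 'b) \<Rightarrow> nat \<Rightarrow> 'b monoid" where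
  "spheres X d n =
     (X n)\<lparr>carrier := {x \<in> carrier (X n). n > 0 \<longrightarrow> (\<forall>i\<le>n. d n i x = \<one>\<^bsub>X (n - 1)\<^esub>)}\<rparr>"

definition null_spheres :: "(nat \<Rightarrow> 'b monoid) \<Rightarrow> (nat \<Rightarrow> nat \<Rightarrow> 'b \<Rightarrow> 'b) \<Rightarrow> nat \<Rightarrow> 'b set" where
  "null_spheres X d n =
     d (n + 1) (n + 1) ` {y \<in> carrier (X (n + 1)). \<forall>i\<le>n. d (n + 1) i y = \<one>\<^bsub>X n\<^esub>}"

definition homotopy_group ::
  "(nat \<Rightarrow> 'b monoid) \<Rightarrow> (nat \<Rightarrow> nat \<Rightarrow> 'b \<Rightarrow> 'b) \<Rightarrow> nat \<Rightarrow> 'b set monoid" where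
  "homotopy_group X d n = spheres X d n Mod null_spheres X d n"

text \<open>The simplicial abelian group \<open>\<Lambda>\<^sup>2(K P\<^sub>*)\<close> for the resolution \<open>P\<^sub>*\<close> of \<open>A\<close>.\<close>

definition ext2_simp ::
  "'a monoid \<Rightarrow> nat \<Rightarrow> ((nat set \<Rightarrow> ('a \<Rightarrow>\<^sub>0 int)) list \<Rightarrow>\<^sub>0 int) set monoid" where
  "ext2_simp A n = ext_power 2 (dold_kan (res A) res_diff n)"

definition ext2_face ::
  "'a monoid \<Rightarrow> nat \<Rightarrow> nat \<Rightarrow> ((nat set \<Rightarrow> ('a \<Rightarrow>\<^sub>0 int)) list \<Rightarrow>\<^sub>0 int) set \<Rightarrow>
   ((nat set \<Rightarrow> ('a \<Rightarrow>\<^sub>0 int)) list \<Rightarrow>\<^sub>0 int) set" where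
  "ext2_face A n i = ext_power_map 2 (dold_kan (res A) res_diff (n - 1)) (dold_kan_face i)"

type_synonym 'a omega2 = "((nat set \<Rightarrow> ('a \<Rightarrow>\<^sub>0 int)) list \<Rightarrow>\<^sub>0 int) set set"

definition omega2 :: "'a monoid \<Rightarrow> 'a omega2 monoid" where
  "omega2 A = homotopy_group (ext2_simp A) (ext2_face A) 1"

definition omega2_map :: "'b monoid \<Rightarrow> ('a \<Rightarrow> 'b) \<Rightarrow> 'a omega2 \<Rightarrow> 'b omega2" where
  "omega2_map B f =
     quot_map (spheres (ext2_simp B) (ext2_face B) 1) (null_spheres (ext2_simp B) (ext2_face B) 1)
       (ext_power_map 2 (dold_kan (res B) res_diff 1) (\<lambda>c S. frag_map f (c S)))"

definition Omega2_functor :: "('a, 'a omega2) ab_functor" where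
  "Omega2_functor = \<lparr>on_ob = omega2, on_hom = (\<lambda>A B f. omega2_map B f)\<rparr>"

end

theory Submission
  imports Defs "HOL-Library.Z2" "HOL-Library.Product_Plus"
begin

text \<open>
  The two-torsion of a rank three group already obstructs a splitting. Let \<open>a, b, c\<close> be elements of
  order two. A bar two-chain with boundary \<open>2[x]\<close>, namely \<open>[x|x] + [1|1]\<close>, exists for every \<open>x\<close> of
  order two, and it turns a pair \<open>x, y\<close> of such elements into a three-cycle \<open>\<tau>(x, y)\<close>, functorially
  in the pair (\<open>tor_cycle\<close>); it represents the class that the Kuenneth theorem attaches to
  \<open>Tor(\<int>/2, \<int>/2)\<close>. This class is not additive in \<open>y\<close>: its deviation from additivity is the
  Pontryagin product,
  \<open>\<tau>(a, b + c) - \<tau>(a, b) - \<tau>(a, c) = a \<cdot> b \<cdot> c\<close> in homology (\<open>letter_product_eq_tor_cycles\<close>).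

  Suppose that \<open>r\<close> is a natural retraction, and take for \<open>a, b, c\<close> the basis of \<open>(\<int>/2)\<^sup>3\<close>. Every
  \<open>\<tau>(a, y)\<close> is the image of \<open>\<tau>(a, b)\<close> under an endomorphism of rank at most two, and the exterior cube
  of such an endomorphism is killed by the determinant \<open>\<Lambda>\<^sup>3((\<int>/2)\<^sup>3) \<rightarrow> \<int>/2\<close>. So by naturality
  the determinant of \<open>r\<close> vanishes on all the \<open>\<tau>(a, y)\<close>, and by the relation above it vanishes on
  \<open>r(a \<cdot> b \<cdot> c) = a \<and> b \<and> c\<close>, whose determinant is 1 (\<open>no_natural_retraction\<close>).

  A natural section \<open>s\<close> of the projection \<open>p\<close> yields a natural retraction, the inverse of the injection
  applied to \<open>x - s(p(x))\<close> (\<open>natural_section_imp_natural_retraction\<close>), so that there is no section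
  either, for any choice of \<open>p\<close>.

  All this uses values of maps on classes, so the maps have to be well defined. For the map
  \<open>\<Lambda>\<^sup>3 \<rightarrow> H\<^sub>3\<close> this rests on two facts: the product of three letters is an alternating sum over the
  permutations, so it is alternating on the nose, and its deviation from additivity in the first letter
  is the boundary of a product with \<open>[a|b]\<close>.
\<close>

section \<open>Homomorphisms between quotients\<close>

text \<open>The union that defines the induced map runs over equal cosets as soon as \<open>h\<close> maps \<open>N\<close> into
  \<open>N'\<close>.\<close>

lemma quot_map_coset:
  assumes G: "group G" and G': "group G'" and N: "subgroup N G" and N': "subgroup N' G'"
    and h: "h \<in> hom G G'" "h ` N \<subseteq> N'" and x: "x \<in> carrier G"
  shows "quot_map G' N' h (N #>\<^bsub>G\<^esub> x) = N' #>\<^bsub>G'\<^esub> h x"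
proof -
  interpret G': group G' by fact
  have "N' #>\<^bsub>G'\<^esub> h (n \<otimes>\<^bsub>G\<^esub> x) = N' #>\<^bsub>G'\<^esub> h x" if "n \<in> N" for n
  proof -
    have n: "n \<in> carrier G" "h n \<in> N'"
      using that N h(2) by (auto dest: subgroup.mem_carrier)
    then have "N' #>\<^bsub>G'\<^esub> h (n \<otimes>\<^bsub>G\<^esub> x) = (N' #>\<^bsub>G'\<^esub> h n) #>\<^bsub>G'\<^esub> h x"
      using h(1) x N' by (simp add: hom_mult hom_in_carrier G'.coset_mult_assoc subgroup.subset)
    also have "N' #>\<^bsub>G'\<^esub> h n = N'"
      using n N' h(1) by (simp add: G'.coset_join2 hom_in_carrier)
    finally show ?thesis .
  qed
  moreover have "N \<noteq> {}"
    using N by (auto dest: subgroup.one_closed)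
  ultimately show ?thesis
    by (auto simp: quot_map_def r_coset_def[of G])
qed

lemma quot_map_hom:
  assumes G: "comm_group G" and G': "comm_group G'" and N: "subgroup N G" and N': "subgroup N' G'"
    and h: "h \<in> hom G G'" "h ` N \<subseteq> N'"
  shows "quot_map G' N' h \<in> hom (G Mod N) (G' Mod N')"
proof -
  interpret G: comm_group G by fact
  interpret G': comm_group G' by fact
  interpret N: normal N G using N by (rule G.subgroup_imp_normal)
  interpret N': normal N' G' using N' by (rule G'.subgroup_imp_normal)
  note coset = quot_map_coset[OF G.is_group G'.is_group N N' h]
  show ?thesis
  proof (rule homI)
    fix X assume "X \<in> carrier (G Mod N)"
    then obtain x where "x \<in> carrier G" "X = N #>\<^bsub>G\<^esub> x"
      by (auto simp: carrier_FactGroup)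
    then show "quot_map G' N' h X \<in> carrier (G' Mod N')"
      using h(1) by (auto simp: carrier_FactGroup coset hom_in_carrier)
    fix Y assume "Y \<in> carrier (G Mod N)"
    then obtain y where "y \<in> carrier G" "Y = N #>\<^bsub>G\<^esub> y"
      by (auto simp: carrier_FactGroup)
    with \<open>x \<in> carrier G\<close> \<open>X = N #>\<^bsub>G\<^esub> x\<close>
    show "quot_map G' N' h (X \<otimes>\<^bsub>G Mod N\<^esub> Y) = quot_map G' N' h X \<otimes>\<^bsub>G' Mod N'\<^esub> quot_map G' N' h Y"
      using h(1) by (simp add: coset N.rcos_sum N'.rcos_sum hom_mult hom_in_carrier)
  qed
qed

lemma hom_image_generate_subset:
  assumes "group G" "group H" "h \<in> hom G H" "R \<subseteq> carrier G" "subgroup K H" "h ` R \<subseteq> K"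
  shows "h ` generate G R \<subseteq> K"
proof -
  interpret group_hom G H h
    using assms by (simp add: group_hom_def group_hom_axioms_def)
  show ?thesis
    using generate_img[OF assms(4)] H.generate_subgroup_incl[OF assms(6,5)] by simp
qed

section \<open>Splittings of a natural short exact sequence\<close>

text \<open>The splitting lemma, with the retraction \<open>x \<mapsto> i\<inverse>(x - s(p(x)))\<close>. It is a natural
  homomorphism because \<open>i\<close> is one and is injective.\<close>

lemma natural_section_imp_natural_retraction:
  assumes ex: "short_exact F i G p H" and sec: "natural_section G p H s"
    and F: "\<And>A. fg_ab A \<Longrightarrow> group (on_ob F A)"
    and G: "\<And>A. fg_ab A \<Longrightarrow> group (on_ob G A)"
    and G_comm: "\<And>A x y. fg_ab A \<Longrightarrow> x \<in> carrier (on_ob G A) \<Longrightarrow> y \<in> carrier (on_ob G A) \<Longrightarrow>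
      x \<otimes>\<^bsub>on_ob G A\<^esub> y = y \<otimes>\<^bsub>on_ob G A\<^esub> x"
    and F_map: "\<And>A B f. fg_ab A \<Longrightarrow> fg_ab B \<Longrightarrow> f \<in> hom A B \<Longrightarrow>
      on_hom F A B f \<in> hom (on_ob F A) (on_ob F B)"
    and G_map: "\<And>A B f. fg_ab A \<Longrightarrow> fg_ab B \<Longrightarrow> f \<in> hom A B \<Longrightarrow>
      on_hom G A B f \<in> hom (on_ob G A) (on_ob G B)"
  shows "\<exists>r. natural_retraction F i G r"
proof -
  have i: "i A \<in> hom (on_ob F A) (on_ob G A)" "inj_on (i A) (carrier (on_ob F A))"
      "i A ` carrier (on_ob F A) = kernel (on_ob G A) (on_ob H A) (p A)"
    and p: "p A \<in> hom (on_ob G A) (on_ob H A)"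
    and s: "s A \<in> hom (on_ob H A) (on_ob G A)" "z \<in> carrier (on_ob H A) \<Longrightarrow> p A (s A z) = z"
    if "fg_ab A" for A z
    using ex sec that by (auto simp: short_exact_def natural_section_def nat_trans_def)
  have nat: "i B (on_hom F A B f x) = on_hom G A B f (i A x)"
      "p B (on_hom G A B f y) = on_hom H A B f (p A y)"
      "s B (on_hom H A B f z) = on_hom G A B f (s A z)"
    if "fg_ab A" "fg_ab B" "f \<in> hom A B" "x \<in> carrier (on_ob F A)" "y \<in> carrier (on_ob G A)"
      "z \<in> carrier (on_ob H A)" for A B f x y z
    using ex sec that by (auto simp: short_exact_def natural_section_def nat_trans_def)
  define q where "q A x = x \<otimes>\<^bsub>on_ob G A\<^esub> inv\<^bsub>on_ob G A\<^esub> s A (p A x)" for A x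
  define r where "r A x = inv_into (carrier (on_ob F A)) (i A) (q A x)" for A x
  \<comment> \<open>The neutral element is in the image of \<open>i\<close>, that is, in the kernel of \<open>p\<close>.\<close>
  have p_one: "p A \<one>\<^bsub>on_ob G A\<^esub> = \<one>\<^bsub>on_ob H A\<^esub>" if "fg_ab A" for A
  proof -
    have "\<one>\<^bsub>on_ob G A\<^esub> = i A \<one>\<^bsub>on_ob F A\<^esub>"
      using i(1)[OF that] F[OF that] G[OF that] by (simp add: hom_one)
    also have "\<dots> \<in> kernel (on_ob G A) (on_ob H A) (p A)"
      using i(3)[OF that] monoid.one_closed[OF group.is_monoid[OF F[OF that]]] by blast
    finally show ?thesis
      by (simp add: kernel_def)
  qed
  have sp: "s A (p A x) \<in> carrier (on_ob G A)" if "fg_ab A" "x \<in> carrier (on_ob G A)" for A x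
    using that p[of A] s(1)[of A] by (auto simp: hom_def)
  have r: "r A x \<in> carrier (on_ob F A)" "i A (r A x) = q A x"
    if A: "fg_ab A" and x: "x \<in> carrier (on_ob G A)" for A x
  proof -
    interpret G: group "on_ob G A" by (rule G[OF A])
    define y where "y = s A (p A x)"
    have y: "y \<in> carrier (on_ob G A)" "p A y = p A x"
      using sp[OF A x] s(2)[OF A] p[OF A] x by (auto simp: y_def hom_def)
    have "p A (q A x) = p A x \<otimes>\<^bsub>on_ob H A\<^esub> p A (inv\<^bsub>on_ob G A\<^esub> y)"
      using x y p[OF A] by (simp add: q_def y_def hom_mult)
    also have "\<dots> = p A (y \<otimes>\<^bsub>on_ob G A\<^esub> inv\<^bsub>on_ob G A\<^esub> y)"
      using y hom_mult[OF p[OF A] y(1), of "inv\<^bsub>on_ob G A\<^esub> y"] by simp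
    finally have "q A x \<in> kernel (on_ob G A) (on_ob H A) (p A)"
      using x y p_one[OF A] by (simp add: kernel_def q_def y_def)
    then have "q A x \<in> i A ` carrier (on_ob F A)"
      using i(3)[OF A] by simp
    then show "r A x \<in> carrier (on_ob F A)" "i A (r A x) = q A x"
      by (simp_all add: r_def inv_into_into f_inv_into_f)
  qed
  have eqI: "x = y" if "fg_ab A" "i A x = i A y" "x \<in> carrier (on_ob F A)" "y \<in> carrier (on_ob F A)"
    for A x y
    using i(2)[OF that(1)] that(2-) by (auto dest: inj_onD)
  have "r A \<in> hom (on_ob G A) (on_ob F A)" if A: "fg_ab A" for A
  proof (rule homI)
    interpret F: group "on_ob F A" by (rule F[OF A])
    interpret G: comm_group "on_ob G A"
      using G[OF A] G_comm[OF A] by (rule group.group_comm_groupI)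
    fix x y assume xy: "x \<in> carrier (on_ob G A)" "y \<in> carrier (on_ob G A)"
    have "q A (x \<otimes>\<^bsub>on_ob G A\<^esub> y) = q A x \<otimes>\<^bsub>on_ob G A\<^esub> q A y"
      using xy sp[OF A] hom_in_carrier[OF p[OF A]]
      by (simp add: q_def hom_mult[OF p[OF A]] hom_mult[OF s(1)[OF A]] G.inv_mult G.m_ac)
    then show "r A (x \<otimes>\<^bsub>on_ob G A\<^esub> y) = r A x \<otimes>\<^bsub>on_ob F A\<^esub> r A y"
      using xy r[OF A] by (intro eqI[OF A]) (simp_all add: hom_mult[OF i(1)[OF A]])
  qed (rule r(1)[OF A])
  moreover have "r B (on_hom G A B f x) = on_hom F A B f (r A x)"
    if AB: "fg_ab A" "fg_ab B" and f: "f \<in> hom A B" and x: "x \<in> carrier (on_ob G A)" for A B f x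
  proof -
    have fx: "on_hom G A B f x \<in> carrier (on_ob G B)"
      using G_map[OF AB f] x by (rule hom_in_carrier)
    have px: "p A x \<in> carrier (on_ob H A)"
      using p[OF AB(1)] x by (rule hom_in_carrier)
    interpret group_hom "on_ob G A" "on_ob G B" "on_hom G A B f"
      using G[OF AB(1)] G[OF AB(2)] G_map[OF AB f] by (simp add: group_hom_def group_hom_axioms_def)
    have "q B (on_hom G A B f x) = on_hom G A B f (q A x)"
      using x px sp[OF AB(1) x] nat[OF AB f r(1)[OF AB(1) x] x px] by (simp add: q_def)
    also have "\<dots> = i B (on_hom F A B f (r A x))"
      using nat(1)[OF AB f r(1)[OF AB(1) x] x px] r(2)[OF AB(1) x] by simp
    finally show ?thesis
      using r[OF AB(2) fx] hom_in_carrier[OF F_map[OF AB f] r(1)[OF AB(1) x]] by (intro eqI[OF AB(2)]) simp_all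
  qed
  moreover have "r A (i A x) = x" if A: "fg_ab A" and x: "x \<in> carrier (on_ob F A)" for A x
  proof -
    interpret G: group "on_ob G A" by (rule G[OF A])
    have ix: "i A x \<in> carrier (on_ob G A)"
      using i(1)[OF A] x by (rule hom_in_carrier)
    have "p A (i A x) = p A \<one>\<^bsub>on_ob G A\<^esub>"
      using i(3)[OF A] x p_one[OF A] by (auto simp: kernel_def)
    \<comment> \<open>The image of an idempotent under a homomorphism is idempotent, hence neutral in a group.\<close>
    moreover have "s A (p A \<one>\<^bsub>on_ob G A\<^esub>) \<otimes>\<^bsub>on_ob G A\<^esub> s A (p A \<one>\<^bsub>on_ob G A\<^esub>) = s A (p A \<one>\<^bsub>on_ob G A\<^esub>)"
      using hom_mult[OF p[OF A], of "\<one>\<^bsub>on_ob G A\<^esub>" "\<one>\<^bsub>on_ob G A\<^esub>"] hom_in_carrier[OF p[OF A]]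
      by (simp flip: hom_mult[OF s(1)[OF A]])
    then have "s A (p A \<one>\<^bsub>on_ob G A\<^esub>) = \<one>\<^bsub>on_ob G A\<^esub>"
      using sp[OF A] G.l_cancel_one by simp
    ultimately have "q A (i A x) = i A x"
      using ix by (simp add: q_def)
    then show ?thesis
      using r[OF A ix] x by (intro eqI[OF A]) simp_all
  qed
  ultimately have "natural_retraction F i G r"
    by (simp add: natural_retraction_def nat_trans_def)
  then show ?thesis by blast
qed

section \<open>Exterior powers\<close>

lemma ext_relations_carrier:
  assumes "monoid A"
  shows "ext_relations n A \<subseteq> carrier (free_Abelian_group (tuples n A))"
proof -
  interpret monoid A by fact
  have "xs[i := a] \<in> tuples n A" if "xs \<in> tuples n A" "a \<in> carrier A" for xs i a
    using that set_update_subset_insert[of xs i a] by (auto simp: tuples_def)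
  then show ?thesis
    unfolding ext_relations_def
    by (auto simp: keys_frag_of dest!: subsetD[OF keys_diff])
qed

lemma ext_null_subgroup:
  assumes "monoid A"
  shows "subgroup (ext_null n A) (free_Abelian_group (tuples n A))"
  unfolding ext_null_def
  by (intro group.generate_is_subgroup group_free_Abelian_group ext_relations_carrier assms)

lemma ext_power_comm_group:
  assumes "monoid A"
  shows "comm_group (ext_power n A)"
  unfolding ext_power_def
  by (intro comm_group.abelian_FactGroup abelian_free_Abelian_group ext_null_subgroup assms)

lemma frag_map_tuples_hom:
  assumes "f \<in> hom A B"
  shows "frag_map (map f) \<in> hom (free_Abelian_group (tuples n A)) (free_Abelian_group (tuples n B))"
proof (rule homI)
  have "map f xs \<in> tuples n B" if "xs \<in> tuples n A" for xs
    using that assms by (auto simp: tuples_def hom_def)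
  then show "frag_map (map f) c \<in> carrier (free_Abelian_group (tuples n B))"
    if "c \<in> carrier (free_Abelian_group (tuples n A))" for c
    using that keys_frag_extend[of "\<lambda>xs. frag_of (map f xs)" c]
    by (fastforce simp: keys_frag_of)
qed (simp add: frag_extend_add)

lemma frag_map_ext_null:
  assumes A: "group A" and B: "group B" and f: "f \<in> hom A B"
  shows "frag_map (map f) ` ext_null n A \<subseteq> ext_null n B"
  unfolding ext_null_def[of n A]
proof (rule hom_image_generate_subset[where H = "free_Abelian_group (tuples n B)"])
  have tup: "map f xs \<in> tuples n B" if "xs \<in> tuples n A" for xs
    using that f by (auto simp: tuples_def hom_def)
  have "frag_map (map f) ` ext_relations n A \<subseteq> ext_relations n B"
  proof (clarify)
    fix c assume "c \<in> ext_relations n A"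
    then consider xs i a b where "c = frag_of (xs[i := a \<otimes>\<^bsub>A\<^esub> b]) - frag_of (xs[i := a]) - frag_of (xs[i := b])"
        "xs \<in> tuples n A" "i < n" "a \<in> carrier A" "b \<in> carrier A"
      | xs i j where "c = frag_of xs" "xs \<in> tuples n A" "i < j" "j < n" "xs ! i = xs ! j"
      unfolding ext_relations_def by blast
    then show "frag_map (map f) c \<in> ext_relations n B"
    proof cases
      case 1
      then have "frag_map (map f) c = frag_of ((map f xs)[i := f a \<otimes>\<^bsub>B\<^esub> f b]) -
          frag_of ((map f xs)[i := f a]) - frag_of ((map f xs)[i := f b])"
        using f by (simp add: frag_extend_diff map_update hom_mult)
      then show ?thesis
        unfolding ext_relations_def using 1 tup f by (blast intro: hom_in_carrier)
    next
      case 2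
      then have "frag_map (map f) c = frag_of (map f xs)" "map f xs ! i = map f xs ! j"
        by (auto simp: tuples_def)
      then show ?thesis
        unfolding ext_relations_def using 2 tup by blast
    qed
  qed
  then show "frag_map (map f) ` ext_relations n A \<subseteq> ext_null n B"
    unfolding ext_null_def by (auto intro: generate.incl)
qed (intro group_free_Abelian_group frag_map_tuples_hom f ext_relations_carrier ext_null_subgroup
    group.is_monoid A B)+

lemma ext_power_map_hom:
  assumes "group A" "group B" "f \<in> hom A B"
  shows "ext_power_map n B f \<in> hom (ext_power n A) (ext_power n B)"
  unfolding ext_power_map_def ext_power_def using assms
  by (intro quot_map_hom abelian_free_Abelian_group ext_null_subgroup frag_map_tuples_hom
      frag_map_ext_null) (auto intro: group.is_monoid)

text \<open>The linear extension of \<open>D\<close>, by which functionals on exterior powers are described.\<close>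

definition frag_eval :: "('a \<Rightarrow> 'r::ring_1) \<Rightarrow> ('a \<Rightarrow>\<^sub>0 int) \<Rightarrow> 'r" where
  "frag_eval D c = (\<Sum>x\<in>Poly_Mapping.keys c. of_int (Poly_Mapping.lookup c x) * D x)"

lemma frag_eval_superset:
  assumes "finite S" "Poly_Mapping.keys c \<subseteq> S"
  shows "frag_eval D c = (\<Sum>x\<in>S. of_int (Poly_Mapping.lookup c x) * D x)"
  unfolding frag_eval_def using assms
  by (intro sum.mono_neutral_left) (auto simp: in_keys_iff)

lemma frag_eval_0 [simp]: "frag_eval D 0 = 0"
  by (simp add: frag_eval_def)

lemma frag_eval_frag_of [simp]: "frag_eval D (frag_of x) = D x"
  by (simp add: frag_eval_def)

lemma frag_eval_add: "frag_eval D (c + d) = frag_eval D c + frag_eval D d"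
proof -
  let ?S = "Poly_Mapping.keys c \<union> Poly_Mapping.keys d"
  have "Poly_Mapping.keys (c + d) \<subseteq> ?S"
    by (rule Poly_Mapping.keys_add)
  then show ?thesis
    by (simp add: frag_eval_superset[of ?S] lookup_add distrib_right sum.distrib)
qed

lemma frag_eval_minus: "frag_eval D (- c) = - frag_eval D c"
  using frag_eval_add[of D c "- c"] by (simp add: eq_neg_iff_add_eq_0 add.commute)

lemma frag_eval_diff: "frag_eval D (c - d) = frag_eval D c - frag_eval D d"
  using frag_eval_add[of D c "- d"] by (simp add: frag_eval_minus)

lemma frag_eval_frag_map:
  assumes "Poly_Mapping.keys c \<subseteq> S" "\<And>x. x \<in> S \<Longrightarrow> D (g x) = 0"
  shows "frag_eval D (frag_map g c) = 0"
  using assms(1) by (induction c rule: frag_induction) (simp_all add: frag_extend_diff frag_eval_diff assms(2))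

text \<open>An alternating multilinear map kills the relations of the exterior power, hence factors through
  it.\<close>

lemma frag_eval_ext_null:
  assumes A: "monoid A"
    and add: "\<And>xs i a b. xs \<in> tuples n A \<Longrightarrow> i < n \<Longrightarrow> a \<in> carrier A \<Longrightarrow> b \<in> carrier A \<Longrightarrow>
      D (xs[i := a \<otimes>\<^bsub>A\<^esub> b]) = D (xs[i := a]) + D (xs[i := b])"
    and alt: "\<And>xs i j. xs \<in> tuples n A \<Longrightarrow> i < j \<Longrightarrow> j < n \<Longrightarrow> xs ! i = xs ! j \<Longrightarrow> D xs = 0"
    and c: "c \<in> ext_null n A"
  shows "frag_eval D c = 0"
proof -
  interpret F: comm_group "free_Abelian_group (tuples n A)"
    by (rule abelian_free_Abelian_group)
  let ?E = "{c. Poly_Mapping.keys c \<subseteq> tuples n A \<and> frag_eval D c = 0}"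
  have "subgroup ?E (free_Abelian_group (tuples n A))"
  proof (rule F.subgroupI)
    have "0 \<in> ?E"
      by simp
    then show "?E \<noteq> {}"
      by blast
  qed (auto simp: frag_eval_add frag_eval_minus dest!: subsetD[OF Poly_Mapping.keys_add])
  moreover have "ext_relations n A \<subseteq> ?E"
  proof
    fix c assume c: "c \<in> ext_relations n A"
    then have "Poly_Mapping.keys c \<subseteq> tuples n A"
      using subsetD[OF ext_relations_carrier[OF A] c] by simp
    moreover have "frag_eval D c = 0"
      using c add alt unfolding ext_relations_def by (auto simp: frag_eval_diff)
    ultimately show "c \<in> ?E"
      by simp
  qed
  ultimately have "ext_null n A \<subseteq> ?E"
    unfolding ext_null_def by (intro F.generate_subgroup_incl)
  then show ?thesis
    using c by blast
qed

section \<open>The bar complex and group homology\<close>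

lemma keys_diff_subset:
  "Poly_Mapping.keys a \<subseteq> S \<Longrightarrow> Poly_Mapping.keys b \<subseteq> S \<Longrightarrow> Poly_Mapping.keys (a - b) \<subseteq> S"
  using keys_diff[of a b] by blast

lemma keys_add_subset:
  "Poly_Mapping.keys a \<subseteq> S \<Longrightarrow> Poly_Mapping.keys b \<subseteq> S \<Longrightarrow> Poly_Mapping.keys (a + b) \<subseteq> S"
  using Poly_Mapping.keys_add[of a b] by blast

lemma length_bar_face:
  assumes "i \<le> length xs"
  shows "length (bar_face A i xs) = length xs - 1"
  using assms by (auto simp: bar_face_def)

text \<open>This description treats inner and outer faces alike, which makes the simplicial identities a
  comparison of entries.\<close>

lemma nth_bar_face:
  assumes "i \<le> length xs" "k < length xs - 1"
  shows "bar_face A i xs ! k =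
    (if Suc k < i then xs ! k else if Suc k = i then xs ! k \<otimes>\<^bsub>A\<^esub> xs ! Suc k else xs ! Suc k)"
proof -
  have "Suc k - i = Suc m \<Longrightarrow> i + m = k" for m
    by linarith
  then show ?thesis
    using assms
    by (auto simp: bar_face_def nth_tl nth_butlast nth_append min_def nth_Cons split: nat.split)
qed

text \<open>The simplicial identity \<open>d\<^sub>i d\<^sub>j = d\<^sub>j\<^sub>-\<^sub>1 d\<^sub>i\<close> for \<open>i < j\<close>; associativity enters for \<open>j = i + 1\<close>.\<close>

lemma bar_face_bar_face:
  assumes "monoid A" "set xs \<subseteq> carrier A" "i < j" "j \<le> length xs"
  shows "bar_face A i (bar_face A j xs) = bar_face A (j - 1) (bar_face A i xs)"
proof -
  interpret monoid A by fact
  have mem: "xs ! k \<in> carrier A" if "k < length xs" for k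
    using assms(2) that by auto
  show ?thesis
  proof (rule nth_equalityI)
    show "length (bar_face A i (bar_face A j xs)) = length (bar_face A (j - 1) (bar_face A i xs))"
      using assms by (simp add: length_bar_face)
    fix k assume "k < length (bar_face A i (bar_face A j xs))"
    then have "k < length xs - 1 - 1"
      using assms by (simp add: length_bar_face)
    then show "bar_face A i (bar_face A j xs) ! k = bar_face A (j - 1) (bar_face A i xs) ! k"
      using assms mem by (auto simp: nth_bar_face length_bar_face m_assoc)
  qed
qed

lemma set_bar_face:
  assumes "monoid A" "set xs \<subseteq> carrier A" "i \<le> length xs"
  shows "set (bar_face A i xs) \<subseteq> carrier A"
proof -
  interpret monoid A by fact
  have mem: "xs ! k \<in> carrier A" if "k < length xs" for k
    using assms(2) that by auto
  then show ?thesis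
    using assms(3) by (auto simp: in_set_conv_nth length_bar_face nth_bar_face)
qed

lemma bar_boundary_frag_of:
  "bar_boundary A (frag_of xs) = (if xs = [] then 0
     else (\<Sum>i\<le>length xs. frag_cmul ((-1) ^ i) (frag_of (bar_face A i xs))))"
  by (simp add: bar_boundary_def)

lemma bar_boundary_add [simp]: "bar_boundary A (c + d) = bar_boundary A c + bar_boundary A d"
  by (simp add: bar_boundary_def frag_extend_add)

lemma bar_boundary_diff [simp]: "bar_boundary A (c - d) = bar_boundary A c - bar_boundary A d"
  by (simp add: bar_boundary_def frag_extend_diff)

lemma bar_boundary_minus [simp]: "bar_boundary A (- c) = - bar_boundary A c"
  by (simp add: bar_boundary_def frag_extend_minus)

lemma bar_boundary_0 [simp]: "bar_boundary A 0 = 0"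
  by (simp add: bar_boundary_def)

lemma bar_boundary_cmul: "bar_boundary A (frag_cmul k c) = frag_cmul k (bar_boundary A c)"
  by (simp add: bar_boundary_def frag_extend_cmul)

lemma bar_boundary_sum: "finite I \<Longrightarrow> bar_boundary A (sum f I) = (\<Sum>i\<in>I. bar_boundary A (f i))"
  by (simp add: bar_boundary_def frag_extend_sum o_def)

text \<open>By the simplicial identities, the faces \<open>d\<^sub>i d\<^sub>j\<close> with \<open>i < j\<close> cancel against those with
  \<open>i \<ge> j\<close>, under \<open>(j, i) \<mapsto> (i, j - 1)\<close>.\<close>

lemma bar_boundary_bar_boundary_frag_of:
  assumes A: "monoid A" and xs: "set xs \<subseteq> carrier A"
  shows "bar_boundary A (bar_boundary A (frag_of xs)) = 0"
proof (cases "length xs < 2")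
  case True
  then consider "xs = []" | x where "xs = [x]"
    by (cases xs rule: remdups_adj.cases) auto
  then show ?thesis
    by cases (auto simp: bar_boundary_frag_of bar_face_def bar_boundary_cmul)
next
  case False
  define n where "n = length xs - 1"
  have n: "length xs = Suc n" "n > 0"
    using False by (auto simp: n_def)
  define t where "t i j = frag_cmul ((-1) ^ (i + j)) (frag_of (bar_face A i (bar_face A j xs)))" for i j
  have ne: "bar_face A j xs \<noteq> []" if "j \<le> Suc n" for j
    using length_bar_face[of j xs A] that n by auto
  have "bar_boundary A (bar_boundary A (frag_of xs)) =
      (\<Sum>j\<le>Suc n. frag_cmul ((-1) ^ j) (bar_boundary A (frag_of (bar_face A j xs))))"
    using n by (simp add: bar_boundary_frag_of[of A xs] bar_boundary_sum bar_boundary_cmul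
      del: sum.atMost_Suc) auto
  also have "\<dots> = (\<Sum>j\<le>Suc n. \<Sum>i\<le>n. t i j)"
    using n ne
    by (intro sum.cong refl)
      (auto simp: bar_boundary_frag_of length_bar_face frag_cmul_sum t_def power_add mult.commute)
  also have "\<dots> = (\<Sum>(j,i)\<in>{..Suc n} \<times> {..n}. t i j)"
    by (simp add: sum.cartesian_product)
  also have "{..Suc n} \<times> {..n} = {(j,i). i < j \<and> j \<le> Suc n} \<union> {(j,i). j \<le> i \<and> i \<le> n}"
    by auto
  also have "(\<Sum>(j,i)\<in>\<dots>. t i j) =
      (\<Sum>(j,i)\<in>{(j,i). i < j \<and> j \<le> Suc n}. t i j) + (\<Sum>(j,i)\<in>{(j,i). j \<le> i \<and> i \<le> n}. t i j)"
    by (rule sum.union_disjoint) (auto intro: finite_subset[of _ "{..Suc n} \<times> {..Suc n}"])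
  also have "(\<Sum>(j,i)\<in>{(j,i). i < j \<and> j \<le> Suc n}. t i j) = (\<Sum>(j,i)\<in>{(j,i). j \<le> i \<and> i \<le> n}. - t i j)"
  proof (rule sum.reindex_bij_witness[where j = "\<lambda>(j,i). (i, j - 1)" and i = "\<lambda>(j,i). (Suc i, j)"]; clarsimp)
    fix i j assume "i < j" "j \<le> Suc n"
    then have "j \<noteq> 0" "bar_face A i (bar_face A j xs) = bar_face A (j - 1) (bar_face A i xs)"
      using bar_face_bar_face[OF A xs] n by auto
    moreover have "(-1) ^ (i + j) = - ((-1 :: int) ^ (j - Suc 0 + i))"
      using \<open>j \<noteq> 0\<close> by (cases j) (auto simp: add.commute)
    ultimately show "- t (j - Suc 0) i = t i j"
      by (simp add: t_def)
  qed auto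
  finally show ?thesis
    by (simp add: case_prod_unfold sum_negf)
qed

lemma bar_boundary_bar_boundary:
  assumes "monoid A" "Poly_Mapping.keys c \<subseteq> tuples n A"
  shows "bar_boundary A (bar_boundary A c) = 0"
  using assms(2)
proof (induction c rule: frag_induction)
  case (one xs)
  then show ?case
    using bar_boundary_bar_boundary_frag_of[OF assms(1)] by (simp add: tuples_def)
qed auto

lemma bar_face_map:
  assumes "f \<in> hom A B" "set xs \<subseteq> carrier A" "i \<le> length xs"
  shows "bar_face B i (map f xs) = map f (bar_face A i xs)"
proof (rule nth_equalityI)
  fix k assume "k < length (bar_face B i (map f xs))"
  then have "k < length xs - 1"
    using assms(3) by (simp add: length_bar_face)
  moreover from this have "xs ! k \<in> carrier A" "xs ! Suc k \<in> carrier A"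
    using assms(2) by auto
  ultimately show "bar_face B i (map f xs) ! k = map f (bar_face A i xs) ! k"
    using assms(1,3) by (auto simp: nth_bar_face length_bar_face hom_mult)
qed (use assms(3) in \<open>simp add: length_bar_face\<close>)

lemma frag_map_bar_boundary:
  assumes "f \<in> hom A B" "Poly_Mapping.keys c \<subseteq> tuples n A"
  shows "frag_map (map f) (bar_boundary A c) = bar_boundary B (frag_map (map f) c)"
  using assms(2)
proof (induction c rule: frag_induction)
  case (one xs)
  then show ?case
    using bar_face_map[OF assms(1), of xs]
    by (auto simp: bar_boundary_frag_of tuples_def frag_extend_sum frag_extend_cmul intro!: sum.cong)
qed (auto simp: frag_extend_diff)

lemma carrier_bar_cycles:
  "carrier (bar_cycles n A) = {c. Poly_Mapping.keys c \<subseteq> tuples n A \<and> bar_boundary A c = 0}"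
  by (simp add: bar_cycles_def)

lemma mult_bar_cycles [simp]: "c \<otimes>\<^bsub>bar_cycles n A\<^esub> d = c + d"
  by (simp add: bar_cycles_def)

lemma bar_cycles_comm_group: "comm_group (bar_cycles n A)"
proof -
  interpret F: comm_group "free_Abelian_group (tuples n A)"
    by (rule abelian_free_Abelian_group)
  have "subgroup {c \<in> carrier (free_Abelian_group (tuples n A)). bar_boundary A c = 0}
      (free_Abelian_group (tuples n A))"
  proof (rule F.subgroupI)
    have "0 \<in> {c \<in> carrier (free_Abelian_group (tuples n A)). bar_boundary A c = 0}"
      by simp
    then show "{c \<in> carrier (free_Abelian_group (tuples n A)). bar_boundary A c = 0} \<noteq> {}"
      by blast
  qed (blast, simp_all add: keys_add_subset)
  then have "group (bar_cycles n A)"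
    unfolding bar_cycles_def by (rule F.subgroup_imp_group)
  then show ?thesis
    by (rule group.group_comm_groupI) (simp add: add.commute)
qed

lemma bar_cycles_group: "group (bar_cycles n A)"
  using bar_cycles_comm_group by (rule comm_group.axioms)

lemma keys_bar_boundary:
  assumes "monoid A" "Poly_Mapping.keys c \<subseteq> tuples (Suc n) A"
  shows "Poly_Mapping.keys (bar_boundary A c) \<subseteq> tuples n A"
  using assms(2)
proof (induction c rule: frag_induction)
  case (one xs)
  have "bar_face A i xs \<in> tuples n A" if "i \<le> length xs" for i
    using one that set_bar_face[OF assms(1), of xs i] by (simp add: tuples_def length_bar_face)
  then show ?case
    by (auto simp: bar_boundary_frag_of keys_frag_of dest!: subsetD[OF keys_sum])
next
  case (diff a b)
  then show ?case by (simp add: keys_diff_subset)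
qed auto

lemma bar_boundaries_subgroup:
  assumes "monoid A"
  shows "subgroup (bar_boundaries n A) (bar_cycles n A)"
proof -
  have "bar_boundary A \<in> hom (free_Abelian_group (tuples (Suc n) A)) (bar_cycles n A)"
    using assms by (intro homI) (simp_all add: carrier_bar_cycles bar_boundary_bar_boundary keys_bar_boundary)
  then interpret group_hom "free_Abelian_group (tuples (Suc n) A)" "bar_cycles n A" "bar_boundary A"
    by (simp add: group_hom_def group_hom_axioms_def bar_cycles_group)
  show ?thesis
    unfolding bar_boundaries_def using G.subgroup_self by (rule subgroup_img_is_subgroup)
qed

lemma group_homology_comm_group:
  assumes "monoid A"
  shows "comm_group (group_homology n A)"
  unfolding group_homology_def
  by (intro comm_group.abelian_FactGroup bar_cycles_comm_group bar_boundaries_subgroup assms)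

lemma frag_map_bar_cycles_hom:
  assumes "f \<in> hom A B"
  shows "frag_map (map f) \<in> hom (bar_cycles n A) (bar_cycles n B)"
  using hom_in_carrier[OF frag_map_tuples_hom[OF assms, of n]]
  by (intro homI) (simp_all add: carrier_bar_cycles frag_extend_add flip: frag_map_bar_boundary[OF assms, of _ n])

lemma frag_map_bar_boundaries:
  assumes "f \<in> hom A B"
  shows "frag_map (map f) ` bar_boundaries n A \<subseteq> bar_boundaries n B"
  unfolding bar_boundaries_def
proof clarify
  fix c assume "c \<in> carrier (free_Abelian_group (tuples (Suc n) A))"
  then have "frag_map (map f) c \<in> carrier (free_Abelian_group (tuples (Suc n) B))"
      "frag_map (map f) (bar_boundary A c) = bar_boundary B (frag_map (map f) c)"
    using hom_in_carrier[OF frag_map_tuples_hom[OF assms]] frag_map_bar_boundary[OF assms] by simp_all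
  then show "frag_map (map f) (bar_boundary A c) \<in>
      bar_boundary B ` carrier (free_Abelian_group (tuples (Suc n) B))"
    by blast
qed

lemma group_homology_map_hom:
  assumes "monoid A" "monoid B" "f \<in> hom A B"
  shows "group_homology_map n B f \<in> hom (group_homology n A) (group_homology n B)"
  unfolding group_homology_map_def group_homology_def using assms
  by (intro quot_map_hom bar_cycles_comm_group bar_boundaries_subgroup frag_map_bar_cycles_hom
      frag_map_bar_boundaries)

lemma group_homology_map_coset:
  assumes "monoid A" "monoid B" "f \<in> hom A B" "c \<in> carrier (bar_cycles n A)"
  shows "group_homology_map n B f (bar_boundaries n A #>\<^bsub>bar_cycles n A\<^esub> c) =
    bar_boundaries n B #>\<^bsub>bar_cycles n B\<^esub> frag_map (map f) c"
  unfolding group_homology_map_def using assms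
  by (intro quot_map_coset bar_boundaries_subgroup frag_map_bar_cycles_hom
      frag_map_bar_boundaries bar_cycles_group)

section \<open>Shuffle products in low degrees\<close>

lemma bar_boundary_single: "bar_boundary A (frag_of [x]) = 0"
  by (simp add: bar_boundary_frag_of bar_face_def)

lemma bar_boundary_pair:
  "bar_boundary A (frag_of [x, y]) = frag_of [y] - frag_of [x \<otimes>\<^bsub>A\<^esub> y] + frag_of [x]"
  by (simp add: bar_boundary_frag_of bar_face_def)

lemma bar_boundary_triple:
  "bar_boundary A (frag_of [x, y, z]) =
     frag_of [y, z] - frag_of [x \<otimes>\<^bsub>A\<^esub> y, z] + frag_of [x, y \<otimes>\<^bsub>A\<^esub> z] - frag_of [x, y]"
  by (simp add: bar_boundary_frag_of bar_face_def eval_nat_numeral)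

lemma bar_boundary_quadruple:
  "bar_boundary A (frag_of [x, y, z, w]) =
     frag_of [y, z, w] - frag_of [x \<otimes>\<^bsub>A\<^esub> y, z, w] + frag_of [x, y \<otimes>\<^bsub>A\<^esub> z, w]
       - frag_of [x, y, z \<otimes>\<^bsub>A\<^esub> w] + frag_of [x, y, z]"
  by (simp add: bar_boundary_frag_of bar_face_def eval_nat_numeral)

lemmas bar_boundary_simps =
  bar_boundary_single bar_boundary_pair bar_boundary_triple bar_boundary_quadruple

lemma pontryagin_frag_of [simp]: "pontryagin (frag_of xs) (frag_of ys) = shuffle_lists xs ys"
  by (simp add: pontryagin_def)

lemma pontryagin_0_right [simp]: "pontryagin c 0 = 0"
  by (simp add: pontryagin_def frag_extend_eq_0)

lemma pontryagin_add_left: "pontryagin (c + c') d = pontryagin c d + pontryagin c' d"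
  by (simp add: pontryagin_def frag_extend_add)

lemma pontryagin_diff_left: "pontryagin (c - c') d = pontryagin c d - pontryagin c' d"
  by (simp add: pontryagin_def frag_extend_diff)

lemma pontryagin_add_right: "pontryagin c (d + d') = pontryagin c d + pontryagin c d'"
  using subset_UNIV by (induction c rule: frag_induction) (auto simp: pontryagin_def frag_extend_add frag_extend_diff)

lemma pontryagin_diff_right: "pontryagin c (d - d') = pontryagin c d - pontryagin c d'"
  using subset_UNIV by (induction c rule: frag_induction) (auto simp: pontryagin_def frag_extend_diff)

lemmas pontryagin_simps =
  pontryagin_add_left pontryagin_diff_left pontryagin_add_right pontryagin_diff_right

lemmas frag_extend_simps = frag_extend_add frag_extend_diff frag_extend_minus

text \<open>The next three lemmas are instances of the Leibniz rule for the shuffle product. The terms in which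
  an inner face merges letters of the two factors occur twice with opposite signs and cancel because
  the group is commutative. A letter is a cycle, so only one term is left for products with a letter.
  In the product of two pairs, the second term has its factors swapped; chains of even degree commute
  under shuffles.\<close>

lemma bar_boundary_letter_pair:
  assumes "comm_group A" "x \<in> carrier A" "y \<in> carrier A" "z \<in> carrier A"
  shows "bar_boundary A (pontryagin (frag_of [x]) (frag_of [y, z])) =
    - pontryagin (frag_of [x]) (bar_boundary A (frag_of [y, z]))"
proof -
  interpret comm_group A by fact
  show ?thesis
    using assms(2-) by (simp add: bar_boundary_simps pontryagin_simps frag_extend_simps m_comm)
qed

lemma bar_boundary_letter_triple:
  assumes "comm_group A" "x \<in> carrier A" "y \<in> carrier A" "z \<in> carrier A" "w \<in> carrier A"
  shows "bar_boundary A (pontryagin (frag_of [x]) (frag_of [y, z, w])) =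
    - pontryagin (frag_of [x]) (bar_boundary A (frag_of [y, z, w]))"
proof -
  interpret comm_group A by fact
  show ?thesis
    using assms(2-) by (simp add: bar_boundary_simps pontryagin_simps frag_extend_simps m_comm)
qed

lemma bar_boundary_pair_pair:
  assumes "comm_group A" "x \<in> carrier A" "y \<in> carrier A" "z \<in> carrier A" "w \<in> carrier A"
  shows "bar_boundary A (pontryagin (frag_of [x, y]) (frag_of [z, w])) =
    pontryagin (bar_boundary A (frag_of [x, y])) (frag_of [z, w]) +
    pontryagin (bar_boundary A (frag_of [z, w])) (frag_of [x, y])"
proof -
  interpret comm_group A by fact
  show ?thesis
    using assms(2-) by (simp add: bar_boundary_simps pontryagin_simps frag_extend_simps m_comm)
qed

section \<open>The map from the third exterior power to homology\<close>

text \<open>The map that induces \<open>\<Lambda>\<^sup>n \<rightarrow> H\<^sub>n\<close>, on generators.\<close>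

definition letter_product :: "'a list \<Rightarrow> ('a list \<Rightarrow>\<^sub>0 int)" where
  "letter_product xs = foldr (\<lambda>x c. pontryagin (frag_of [x]) c) xs (frag_of [])"

text \<open>The product of the last two letters is the commutator \<open>[y|z] - [z|y]\<close>, so the product of three
  letters is the signed sum over their six orders. The two lemmas that follow read off that it is
  alternating already on chains.\<close>

lemma letter_product_triple:
  "letter_product [x, y, z] = pontryagin (frag_of [x]) (frag_of [y, z] - frag_of [z, y])"
  by (simp add: letter_product_def)

lemma letter_product_swap:
  "letter_product [y, x, z] = - letter_product [x, y, z]"
  "letter_product [x, z, y] = - letter_product [x, y, z]"
  by (simp_all add: letter_product_triple pontryagin_simps frag_extend_simps)

lemma letter_product_repeat:
  "letter_product [x, x, z] = 0" "letter_product [x, z, z] = 0" "letter_product [x, z, x] = 0"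
  by (simp_all add: letter_product_triple pontryagin_simps frag_extend_simps)

lemma bar_boundary_letter_product_triple:
  assumes "comm_group A" "x \<in> carrier A" "y \<in> carrier A" "z \<in> carrier A"
  shows "bar_boundary A (letter_product [x, y, z]) = 0"
proof -
  interpret comm_group A by fact
  show ?thesis
    using assms(2-)
    by (simp add: letter_product_triple pontryagin_diff_right bar_boundary_letter_pair[OF assms(1)]
         del: pontryagin_frag_of)
      (simp add: bar_boundary_pair pontryagin_simps m_comm)
qed

text \<open>The boundary of \<open>[a|b]\<close> measures the failure of \<open>x \<mapsto> [x]\<close> to be additive, and the product of the
  other two letters is a cycle, so the Leibniz rule applied to \<open>[a|b] \<cdot> [y] \<cdot> [z]\<close> gives the failure of the
  triple product.\<close>

lemma letter_product_add_boundary: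
  assumes "comm_group A" "a \<in> carrier A" "b \<in> carrier A" "y \<in> carrier A" "z \<in> carrier A"
  shows "letter_product [a \<otimes>\<^bsub>A\<^esub> b, y, z] - letter_product [a, y, z] - letter_product [b, y, z] =
    - bar_boundary A (pontryagin (frag_of [a, b]) (frag_of [y, z] - frag_of [z, y]))"
proof -
  interpret comm_group A by fact
  show ?thesis
    using assms(2-)
    by (simp add: letter_product_triple pontryagin_simps bar_boundary_pair_pair[OF assms(1)]
         del: pontryagin_frag_of)
      (simp add: bar_boundary_pair pontryagin_simps m_comm del: pontryagin_frag_of)
qed

lemma tuples_3: "xs \<in> tuples 3 A \<longleftrightarrow>
    (\<exists>x y z. xs = [x, y, z] \<and> x \<in> carrier A \<and> y \<in> carrier A \<and> z \<in> carrier A)"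
  by (auto simp: tuples_def length_Suc_conv eval_nat_numeral)

lemma keys_letter_product:
  assumes "x \<in> carrier A" "y \<in> carrier A" "z \<in> carrier A"
  shows "Poly_Mapping.keys (letter_product [x, y, z]) \<subseteq> tuples 3 A"
  using assms
  by (auto simp: letter_product_triple pontryagin_simps frag_extend_simps keys_frag_of tuples_def
      dest!: subsetD[OF keys_diff] subsetD[OF Poly_Mapping.keys_add])

lemma letter_product_hom:
  assumes "comm_group A"
  shows "frag_extend letter_product \<in> hom (free_Abelian_group (tuples 3 A)) (bar_cycles 3 A)"
proof (rule homI)
  fix c assume "c \<in> carrier (free_Abelian_group (tuples 3 A))"
  then have "Poly_Mapping.keys c \<subseteq> tuples 3 A"
    by simp
  then show "frag_extend letter_product c \<in> carrier (bar_cycles 3 A)"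
  proof (induction c rule: frag_induction)
    case (one xs)
    then obtain x y z where "xs = [x, y, z]" "x \<in> carrier A" "y \<in> carrier A" "z \<in> carrier A"
      by (auto simp: tuples_3)
    then show ?case
      by (simp add: carrier_bar_cycles keys_letter_product bar_boundary_letter_product_triple[OF assms])
  qed (simp_all add: carrier_bar_cycles frag_extend_diff keys_diff_subset)
qed (simp add: frag_extend_add)

text \<open>Additivity in the first letter modulo boundaries; as the product is alternating, this
  covers the other letters too.\<close>

lemma letter_product_add:
  assumes A: "comm_group A" and mem: "a \<in> carrier A" "b \<in> carrier A" "y \<in> carrier A" "z \<in> carrier A"
  shows "letter_product [a \<otimes>\<^bsub>A\<^esub> b, y, z] - letter_product [a, y, z] - letter_product [b, y, z]
    \<in> bar_boundaries 3 A"
proof -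
  define e where "e = pontryagin (frag_of [a, b]) (frag_of [y, z] - frag_of [z, y])"
  have "Poly_Mapping.keys (- e) \<subseteq> tuples (Suc 3) A"
    unfolding e_def using mem
    by (auto simp: pontryagin_simps frag_extend_simps keys_frag_of tuples_def
      dest!: subsetD[OF keys_diff] subsetD[OF Poly_Mapping.keys_add])
  then show ?thesis
    unfolding bar_boundaries_def letter_product_add_boundary[OF A mem] e_def[symmetric]
    by (intro image_eqI[of _ _ "- e"]) auto
qed

text \<open>The map \<open>\<Lambda>\<^sup>3 \<rightarrow> H\<^sub>3\<close> is well defined.\<close>

lemma letter_product_ext_null:
  assumes A: "comm_group A"
  shows "frag_extend letter_product ` ext_null 3 A \<subseteq> bar_boundaries 3 A"
  unfolding ext_null_def
proof (rule hom_image_generate_subset)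
  interpret comm_group A by fact
  interpret B: subgroup "bar_boundaries 3 A" "bar_cycles 3 A"
    by (rule bar_boundaries_subgroup[OF is_monoid])
  interpret C: comm_group "bar_cycles 3 A"
    by (rule bar_cycles_comm_group)
  show "ext_relations 3 A \<subseteq> carrier (free_Abelian_group (tuples 3 A))"
    by (rule ext_relations_carrier[OF is_monoid])
  show "frag_extend letter_product \<in> hom (free_Abelian_group (tuples 3 A)) (bar_cycles 3 A)"
    by (rule letter_product_hom[OF A])
  show "subgroup (bar_boundaries 3 A) (bar_cycles 3 A)" "group (bar_cycles 3 A)"
    by unfold_locales
  show "frag_extend letter_product ` ext_relations 3 A \<subseteq> bar_boundaries 3 A"
  proof clarify
    fix c assume "c \<in> ext_relations 3 A"
    then consider xs i a b where "c = frag_of (xs[i := a \<otimes>\<^bsub>A\<^esub> b]) - frag_of (xs[i := a]) - frag_of (xs[i := b])"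
        "xs \<in> tuples 3 A" "i < 3" "a \<in> carrier A" "b \<in> carrier A"
      | xs i j where "c = frag_of xs" "xs \<in> tuples 3 A" "i < j" "j < 3" "xs ! i = xs ! j"
      unfolding ext_relations_def by blast
    then show "frag_extend letter_product c \<in> bar_boundaries 3 A"
    proof cases
      case 1
      then obtain x y z where xs: "xs = [x, y, z]"
          and mem: "x \<in> carrier A" "y \<in> carrier A" "z \<in> carrier A"
        by (auto simp: tuples_3)
      have inv: "- d \<in> bar_boundaries 3 A" if "d \<in> bar_boundaries 3 A" for d
        using that unfolding bar_boundaries_def by (auto intro: image_eqI[of _ _ "- _"])
      consider "i = 0" | "i = 1" | "i = 2"
        using \<open>i < 3\<close> by linarith
      then show ?thesis
      proof cases
        case first: 1
        then show ?thesis
          using letter_product_add[OF A 1(4,5) mem(2,3)] xs 1(1) by (simp add: frag_extend_diff)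
      next
        case second: 2
        have "frag_extend letter_product c =
            - (letter_product [a \<otimes>\<^bsub>A\<^esub> b, x, z] - letter_product [a, x, z] - letter_product [b, x, z])"
          using xs 1(1) second by (simp add: frag_extend_diff letter_product_swap(1)[of x])
        then show ?thesis
          using inv[OF letter_product_add[OF A 1(4,5) mem(1,3)]] by simp
      next
        case third: 3
        then show ?thesis
          using letter_product_add[OF A 1(4,5) mem(1,2)] xs 1(1)
          by (simp add: frag_extend_diff letter_product_swap(1)[of x] letter_product_swap(2)[of _ y])
      qed
    next
      case 2
      then obtain x y z where "xs = [x, y, z]"
        by (auto simp: tuples_3)
      moreover have "i = 0 \<and> j = 1 \<or> i = 0 \<and> j = 2 \<or> i = 1 \<and> j = 2"
        using 2(3,4) by linarith
      ultimately have "letter_product xs = 0"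
        using 2(5) by (auto simp: letter_product_repeat)
      then show ?thesis
        using 2 B.one_closed by (simp add: bar_cycles_def)
    qed
  qed
qed auto

lemma ext_to_homology_coset:
  assumes A: "comm_group A" and xs: "xs \<in> tuples 3 A"
  shows "ext_to_homology 3 A (ext_null 3 A #>\<^bsub>free_Abelian_group (tuples 3 A)\<^esub> frag_of xs) =
    bar_boundaries 3 A #>\<^bsub>bar_cycles 3 A\<^esub> letter_product xs"
proof -
  interpret comm_group A by fact
  have "ext_to_homology 3 A (ext_null 3 A #>\<^bsub>free_Abelian_group (tuples 3 A)\<^esub> frag_of xs) =
      bar_boundaries 3 A #>\<^bsub>bar_cycles 3 A\<^esub> frag_extend letter_product (frag_of xs)"
    unfolding ext_to_homology_def letter_product_def[symmetric]
    using xs letter_product_hom[OF A] letter_product_ext_null[OF A]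
    by (intro quot_map_coset ext_null_subgroup bar_boundaries_subgroup is_monoid
        group_free_Abelian_group bar_cycles_group) auto
  then show ?thesis
    by simp
qed

section \<open>Elements of order two\<close>

text \<open>For \<open>x\<close> of order two, the class of \<open>[x]\<close> has order two, and this chain is the reason: its boundary
  is \<open>2[x]\<close>. The boundary of \<open>[x|x]\<close> alone is \<open>2[x] - [1]\<close>, and the degenerate simplex \<open>[1|1]\<close>, with
  boundary \<open>[1]\<close>, corrects this.\<close>

definition halving :: "'a monoid \<Rightarrow> 'a \<Rightarrow> ('a list \<Rightarrow>\<^sub>0 int)" where
  "halving A x = frag_of [x, x] + frag_of [\<one>\<^bsub>A\<^esub>, \<one>\<^bsub>A\<^esub>]"

lemma bar_boundary_halving:
  assumes "monoid A" "x \<otimes>\<^bsub>A\<^esub> x = \<one>\<^bsub>A\<^esub>"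
  shows "bar_boundary A (halving A x) = frag_of [x] + frag_of [x]"
proof -
  interpret monoid A by fact
  show ?thesis
    using assms(2) by (simp add: halving_def bar_boundary_pair)
qed

text \<open>Both summands have boundary \<open>\<mp> 2 [x] \<cdot> [y]\<close>, with opposite signs because letters anticommute. The
  cycle compares the two reasons for which \<open>2 [x] \<cdot> [y]\<close> is a boundary, one for each factor.\<close>

definition tor_cycle :: "'a monoid \<Rightarrow> 'a \<Rightarrow> 'a \<Rightarrow> ('a list \<Rightarrow>\<^sub>0 int)" where
  "tor_cycle A x y = pontryagin (frag_of [x]) (halving A y) + pontryagin (frag_of [y]) (halving A x)"

lemma bar_boundary_letter_halving:
  assumes "comm_group A" "x \<in> carrier A" "y \<in> carrier A"
  shows "bar_boundary A (pontryagin (frag_of [x]) (halving A y)) =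
    - pontryagin (frag_of [x]) (bar_boundary A (halving A y))"
proof -
  interpret comm_group A by fact
  show ?thesis
    using assms
    by (simp add: halving_def bar_boundary_letter_pair pontryagin_add_right del: pontryagin_frag_of)
qed

lemma bar_boundary_tor_cycle:
  assumes "comm_group A" "x \<in> carrier A" "y \<in> carrier A"
    and "x \<otimes>\<^bsub>A\<^esub> x = \<one>\<^bsub>A\<^esub>" "y \<otimes>\<^bsub>A\<^esub> y = \<one>\<^bsub>A\<^esub>"
  shows "bar_boundary A (tor_cycle A x y) = 0"
proof -
  interpret comm_group A by fact
  show ?thesis
    using assms
    by (simp add: tor_cycle_def bar_boundary_letter_halving bar_boundary_halving is_monoid pontryagin_simps)
qed

text \<open>The defect of additivity of \<open>halving\<close> has boundary \<open>- 2 \<partial>[x|y]\<close>. So its sum with \<open>2[x|y]\<close> is a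
  two-cycle of the group generated by \<open>x\<close> and \<open>y\<close>, and it represents the product
  \<open>[x] \<cdot> [y] = [x|y] - [y|x]\<close>. The three-chain makes this explicit: its first two simplices exchange
  \<open>[xy|xy]\<close> for \<open>[x|x]\<close>, \<open>[y|y]\<close> and the mixed pairs, and the last one removes the degenerate pair
  \<open>[1|x]\<close>.\<close>

lemma pair_commutator_eq_boundary:
  assumes "comm_group A" "x \<in> carrier A" "y \<in> carrier A"
    and "x \<otimes>\<^bsub>A\<^esub> x = \<one>\<^bsub>A\<^esub>" "y \<otimes>\<^bsub>A\<^esub> y = \<one>\<^bsub>A\<^esub>"
  shows "frag_of [x, y] - frag_of [y, x] =
    halving A (x \<otimes>\<^bsub>A\<^esub> y) - halving A x - halving A y + (frag_of [x, y] + frag_of [x, y])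
    + bar_boundary A (frag_of [x, y, x \<otimes>\<^bsub>A\<^esub> y] - frag_of [y, y, x] - frag_of [\<one>\<^bsub>A\<^esub>, \<one>\<^bsub>A\<^esub>, x])"
proof -
  interpret comm_group A by fact
  have "y \<otimes>\<^bsub>A\<^esub> (x \<otimes>\<^bsub>A\<^esub> y) = x"
    using assms m_lcomm[of y x y] by simp
  moreover have "y \<otimes>\<^bsub>A\<^esub> x = x \<otimes>\<^bsub>A\<^esub> y"
    using assms m_comm by simp
  ultimately show ?thesis
    using assms(2-) by (simp add: halving_def bar_boundary_triple)
qed

text \<open>The triple product is the deviation of \<open>\<tau>(a, y)\<close> from additivity in \<open>y\<close>, up to a boundary. In
  \<open>\<tau>(a, bc) - \<tau>(a, b) - \<tau>(a, c)\<close>, the terms with \<open>[bc] - [b] - [c] = - \<partial>[b|c]\<close> are moved to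
  \<open>[a] \<cdot> 2[b|c]\<close> by the Leibniz rule for \<open>halving A a \<cdot> [b|c]\<close>, and then \<open>[a]\<close> is multiplied by
  the defect of \<open>halving\<close> plus \<open>2[b|c]\<close>, which is \<open>[b] \<cdot> [c]\<close> by the previous lemma.\<close>

lemma letter_product_eq_tor_cycles:
  assumes A: "comm_group A" and mem: "a \<in> carrier A" "b \<in> carrier A" "c \<in> carrier A"
    and sq: "a \<otimes>\<^bsub>A\<^esub> a = \<one>\<^bsub>A\<^esub>" "b \<otimes>\<^bsub>A\<^esub> b = \<one>\<^bsub>A\<^esub>" "c \<otimes>\<^bsub>A\<^esub> c = \<one>\<^bsub>A\<^esub>"
  defines "w \<equiv> frag_of [b, c, b \<otimes>\<^bsub>A\<^esub> c] - frag_of [c, c, b] - frag_of [\<one>\<^bsub>A\<^esub>, \<one>\<^bsub>A\<^esub>, b]"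
  shows "letter_product [a, b, c] + tor_cycle A a b + tor_cycle A a c =
    tor_cycle A a (b \<otimes>\<^bsub>A\<^esub> c) +
    bar_boundary A (pontryagin (halving A a) (frag_of [b, c]) - pontryagin (frag_of [a]) w)"
proof -
  interpret comm_group A by fact
  define p where "p = frag_of [b, c]"
  have "bar_boundary A (pontryagin (halving A a) p) =
      pontryagin (bar_boundary A (halving A a)) p + pontryagin (bar_boundary A p) (halving A a)"
    using mem unfolding p_def halving_def
    by (simp add: bar_boundary_pair_pair[OF A] pontryagin_add_left pontryagin_add_right
        del: pontryagin_frag_of)
  also have "\<dots> = pontryagin (frag_of [a]) (p + p) +
      pontryagin (frag_of [c] - frag_of [b \<otimes>\<^bsub>A\<^esub> c] + frag_of [b]) (halving A a)"
    using sq by (simp add: bar_boundary_halving is_monoid p_def bar_boundary_pair pontryagin_simps)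
  finally have 1: "bar_boundary A (pontryagin (halving A a) p) =
     pontryagin (frag_of [a]) (p + p) +
      pontryagin (frag_of [c] - frag_of [b \<otimes>\<^bsub>A\<^esub> c] + frag_of [b]) (halving A a)" .
  have 2: "bar_boundary A (pontryagin (frag_of [a]) w) = - pontryagin (frag_of [a]) (bar_boundary A w)"
    using mem unfolding w_def
    by (simp add: bar_boundary_letter_triple[OF A] pontryagin_diff_right del: pontryagin_frag_of)
  have "letter_product [a, b, c] = pontryagin (frag_of [a])
      (halving A (b \<otimes>\<^bsub>A\<^esub> c) - halving A b - halving A c + (p + p) + bar_boundary A w)"
    unfolding letter_product_triple p_def w_def
    by (rule arg_cong[OF pair_commutator_eq_boundary[OF A mem(2,3) sq(2,3)]])
  then show ?thesis
    using 1 2 by (simp add: tor_cycle_def pontryagin_simps flip: p_def)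
qed

lemma frag_map_tor_cycle:
  assumes A: "group A" and B: "group B" and f: "f \<in> hom A B"
  shows "frag_map (map f) (tor_cycle A x y) = tor_cycle B (f x) (f y)"
  using hom_one[OF f A B]
  by (simp add: tor_cycle_def halving_def pontryagin_simps frag_extend_simps)

lemma keys_tor_cycle:
  assumes "monoid A" "x \<in> carrier A" "y \<in> carrier A"
  shows "Poly_Mapping.keys (tor_cycle A x y) \<subseteq> tuples 3 A"
  using assms monoid.one_closed[OF assms(1)]
  by (auto simp: tor_cycle_def halving_def pontryagin_simps frag_extend_simps keys_frag_of tuples_def
      dest!: subsetD[OF keys_diff] subsetD[OF Poly_Mapping.keys_add])

section \<open>An elementary abelian group of order eight\<close>

lemma fg_ab_finite:
  assumes "comm_group A" "finite (carrier A)"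
  shows "fg_ab A"
proof -
  interpret comm_group A by fact
  have "generate A (carrier A) = carrier A"
    using generate_incl[of "carrier A"] by (auto intro: generate.incl)
  then show ?thesis
    using assms by (auto simp: fg_ab_def)
qed

text \<open>The additive group of \<open>'g\<close>, with its elements renamed along an injection: this realizes a
  concrete group inside an arbitrary infinite type.\<close>

definition transport :: "('g::ab_group_add \<Rightarrow> 'a) \<Rightarrow> 'a monoid" where
  "transport e = \<lparr>carrier = range e, monoid.mult = (\<lambda>x y. e (the_inv e x + the_inv e y)), one = e 0\<rparr>"

lemma transport_simps:
  assumes "inj e"
  shows "carrier (transport e) = range e" "\<one>\<^bsub>transport e\<^esub> = e 0"
    "e u \<otimes>\<^bsub>transport e\<^esub> e v = e (u + v)"
  using assms by (simp_all add: transport_def the_inv_f_f)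

lemma transport_comm_group:
  assumes "inj e"
  shows "comm_group (transport e)"
proof (rule comm_groupI)
  note [simp] = transport_simps[OF assms]
  show "x \<otimes>\<^bsub>transport e\<^esub> y \<otimes>\<^bsub>transport e\<^esub> z = x \<otimes>\<^bsub>transport e\<^esub> (y \<otimes>\<^bsub>transport e\<^esub> z)"
    if "x \<in> carrier (transport e)" "y \<in> carrier (transport e)" "z \<in> carrier (transport e)" for x y z
    using that by (auto simp: add.assoc)
  show "x \<otimes>\<^bsub>transport e\<^esub> y = y \<otimes>\<^bsub>transport e\<^esub> x"
    if "x \<in> carrier (transport e)" "y \<in> carrier (transport e)" for x y
    using that by (auto simp: add.commute)
  show "\<exists>y\<in>carrier (transport e). y \<otimes>\<^bsub>transport e\<^esub> x = \<one>\<^bsub>transport e\<^esub>"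
    if x: "x \<in> carrier (transport e)" for x
  proof -
    obtain u where "x = e u"
      using x by auto
    then show ?thesis
      by (intro bexI[of _ "e (- u)"]) auto
  qed
  show "x \<otimes>\<^bsub>transport e\<^esub> y \<in> carrier (transport e)"
    if "x \<in> carrier (transport e)" "y \<in> carrier (transport e)" for x y
    using that by auto
  show "\<one>\<^bsub>transport e\<^esub> \<otimes>\<^bsub>transport e\<^esub> x = x" if "x \<in> carrier (transport e)" for x
    using that by auto
  show "\<one>\<^bsub>transport e\<^esub> \<in> carrier (transport e)"
    by simp
qed

lemma transport_hom:
  assumes "inj e" "\<And>u v. g (u + v) = g u + g v"
  shows "e \<circ> g \<circ> the_inv e \<in> hom (transport e) (transport e)"
  using assms by (intro homI) (auto simp: transport_simps the_inv_f_f)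

type_synonym 'r vec3 = "'r \<times> 'r \<times> 'r"

definition det3 :: "'r::comm_ring_1 vec3 \<Rightarrow> 'r vec3 \<Rightarrow> 'r vec3 \<Rightarrow> 'r" where
  "det3 = (\<lambda>(p, q, r) (p', q', r') (p'', q'', r'').
    p * (q' * r'' - r' * q'') - q * (p' * r'' - r' * p'') + r * (p' * q'' - q' * p''))"

lemma det3_add:
  "det3 (u + u') v w = det3 u v w + det3 u' v w"
  "det3 u (v + v') w = det3 u v w + det3 u v' w"
  "det3 u v (w + w') = det3 u v w + det3 u v w'"
  by (auto simp: det3_def algebra_simps split: prod.splits)

lemma det3_repeat: "det3 u u v = 0" "det3 u v u = 0" "det3 u v v = 0"
  by (auto simp: det3_def algebra_simps split: prod.splits)

text \<open>The linear map \<open>e\<^sub>1 \<mapsto> e\<^sub>1, e\<^sub>2 \<mapsto> y, e\<^sub>3 \<mapsto> 0\<close>, which has rank at most two.\<close>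

definition to_plane :: "'r::comm_ring_1 vec3 \<Rightarrow> 'r vec3 \<Rightarrow> 'r vec3" where
  "to_plane = (\<lambda>(y, y', y'') (p, q, r). (p + q * y, q * y', q * y''))"

lemma to_plane_add: "to_plane y (u + v) = to_plane y u + to_plane y v"
  by (auto simp: to_plane_def algebra_simps split: prod.splits)

lemma det3_to_plane: "det3 (to_plane y u) (to_plane y v) (to_plane y w) = 0"
  by (auto simp: det3_def to_plane_def algebra_simps split: prod.splits)

lemma bit_add_self: "x + x = (0::bit)"
  by (cases x) simp_all

lemma finite_bit_vec3: "finite (UNIV :: bit vec3 set)"
proof -
  have "(UNIV :: bit set) = {0, 1}"
    by (auto intro: bit.exhaust)
  then have "finite (UNIV :: bit set)"
    by (metis finite.emptyI finite.insertI)
  then show ?thesis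
    by (simp add: finite_Prod_UNIV)
qed

definition det_list :: "('r::comm_ring_1 vec3 \<Rightarrow> 'a) \<Rightarrow> 'a list \<Rightarrow> 'r" where
  "det_list e xs = det3 (the_inv e (xs ! 0)) (the_inv e (xs ! 1)) (the_inv e (xs ! 2))"

text \<open>The determinant is well defined on \<open>\<Lambda>\<^sup>3\<close>.\<close>

lemma det_ext_null:
  assumes e: "inj e" and c: "c \<in> ext_null 3 (transport e)"
  shows "frag_eval (det_list e) c = 0"
proof (rule frag_eval_ext_null[OF _ _ _ c])
  show "monoid (transport e)"
    using transport_comm_group[OF e] by (simp add: comm_group.axioms group.is_monoid)
next
  fix xs a b and i :: nat
  assume "xs \<in> tuples 3 (transport e)" "i < 3" "a \<in> carrier (transport e)" "b \<in> carrier (transport e)"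
  then obtain u v w u' v' where "xs = [e u, e v, e w]" "a = e u'" "b = e v'"
    by (auto simp: tuples_3 transport_simps[OF e])
  moreover have "i = 0 \<or> i = 1 \<or> i = 2"
    using \<open>i < 3\<close> by linarith
  ultimately show "det_list e (xs[i := a \<otimes>\<^bsub>transport e\<^esub> b]) =
      det_list e (xs[i := a]) + det_list e (xs[i := b])"
    using e by (auto simp: det_list_def the_inv_f_f transport_simps det3_add)
next
  fix xs i j
  assume xs: "xs \<in> tuples 3 (transport e)" and ij: "i < j" "j < 3" "xs ! i = xs ! j"
  from xs obtain u v w where "xs = [e u, e v, e w]"
    by (auto simp: tuples_3 transport_simps[OF e])
  moreover have "i = 0 \<and> j = 1 \<or> i = 0 \<and> j = 2 \<or> i = 1 \<and> j = 2"
    using ij(1,2) by linarith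
  ultimately show "det_list e xs = 0"
    using e ij(3) by (auto simp: det_list_def the_inv_f_f det3_repeat inj_eq)
qed

text \<open>The determinant of a triple of vectors in a plane is zero, so it kills the image of
  \<open>\<Lambda>\<^sup>3\<close> of a map of rank at most two. The statement is about all representatives \<open>z\<close> of an element of
  that image.\<close>

lemma det_ext_power_map:
  assumes e: "inj e" and X: "X \<in> carrier (ext_power 3 (transport e))"
    and z: "z \<in> ext_power_map 3 (transport e) (e \<circ> to_plane y \<circ> the_inv e) X"
  shows "frag_eval (det_list e) z = 0"
proof -
  let ?f = "e \<circ> to_plane y \<circ> the_inv e"
  have "monoid (transport e)"
    using transport_comm_group[OF e] by (simp add: comm_group.axioms group.is_monoid)
  then have sub: "subgroup (ext_null 3 (transport e)) (free_Abelian_group (tuples 3 (transport e)))"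
    by (rule ext_null_subgroup)
  obtain x n where x: "x \<in> X" and n: "n \<in> ext_null 3 (transport e)" and "z = n + frag_map (map ?f) x"
    using z by (auto simp: ext_power_map_def quot_map_def r_coset_def)
  obtain m c where "x = m + c" "m \<in> ext_null 3 (transport e)" "Poly_Mapping.keys c \<subseteq> tuples 3 (transport e)"
    using x X by (auto simp: ext_power_def carrier_FactGroup r_coset_def)
  then have "Poly_Mapping.keys x \<subseteq> tuples 3 (transport e)"
    using subsetD[OF subgroup.subset[OF sub], of m] by (simp add: keys_add_subset)
  then have "frag_eval (det_list e) (frag_map (map ?f) x) = 0"
    by (rule frag_eval_frag_map) (use e in \<open>auto simp: tuples_3 det_list_def the_inv_f_f det3_to_plane\<close>)
  then show ?thesis
    using \<open>z = _\<close> det_ext_null[OF e n] by (simp add: frag_eval_add)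
qed

section \<open>The sequence does not split\<close>

lemma no_natural_retraction:
  "\<not> (\<exists>r :: 'a::infinite monoid \<Rightarrow> _. natural_retraction (Ext_functor 3) (ext_to_homology 3) (Homology_functor 3) r)"
proof
  assume "\<exists>r :: 'a monoid \<Rightarrow> _. natural_retraction (Ext_functor 3) (ext_to_homology 3) (Homology_functor 3) r"
  then obtain r :: "'a monoid \<Rightarrow> ('a list \<Rightarrow>\<^sub>0 int) set \<Rightarrow> ('a list \<Rightarrow>\<^sub>0 int) set"
    where r: "natural_retraction (Ext_functor 3) (ext_to_homology 3) (Homology_functor 3) r"
    by blast
  obtain e :: "bit vec3 \<Rightarrow> 'a" where e: "inj e"
    using arb_inj_on_finite_infinite[of "UNIV :: bit vec3 set"] finite_bit_vec3 by auto
  define A where "A = transport e"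
  interpret A: comm_group A
    unfolding A_def by (rule transport_comm_group[OF e])
  have fg: "fg_ab A"
    by (rule fg_ab_finite[OF A.comm_group_axioms]) (simp add: A_def transport_simps[OF e] finite_bit_vec3)
  have r_hom: "r A \<in> hom (group_homology 3 A) (ext_power 3 A)"
    using r fg by (simp add: natural_retraction_def nat_trans_def Ext_functor_def Homology_functor_def)
  have r_nat: "r A (group_homology_map 3 A f x) = ext_power_map 3 A f (r A x)"
    if "f \<in> hom A A" "x \<in> carrier (group_homology 3 A)" for f x
    using r fg that by (simp add: natural_retraction_def nat_trans_def Ext_functor_def Homology_functor_def)
  have r_retr: "r A (ext_to_homology 3 A z) = z" if "z \<in> carrier (ext_power 3 A)" for z
    using r fg that by (simp add: natural_retraction_def Ext_functor_def Homology_functor_def)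

  let ?F = "free_Abelian_group (tuples 3 A)" and ?C = "bar_cycles 3 A"
  interpret C: comm_group ?C
    by (rule bar_cycles_comm_group)
  interpret B: normal "bar_boundaries 3 A" ?C
    by (rule C.subgroup_imp_normal[OF bar_boundaries_subgroup[OF A.is_monoid]])
  define a b c where abc: "a = e (1, 0, 0)" "b = e (0, 1, 0)" "c = e (0, 0, 1)"
  have mem: "e u \<in> carrier A" for u
    by (simp add: A_def transport_simps[OF e])
  have sq: "e u \<otimes>\<^bsub>A\<^esub> e u = \<one>\<^bsub>A\<^esub>" for u
    by (cases u) (simp add: A_def transport_simps[OF e] bit_add_self zero_prod_def)
  have bc: "b \<otimes>\<^bsub>A\<^esub> c = e (0, 1, 1)"
    by (simp add: A_def abc transport_simps[OF e])
  define T where "T u = bar_boundaries 3 A #>\<^bsub>?C\<^esub> tor_cycle A a (e u)" for u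
  have cyc: "tor_cycle A a (e u) \<in> carrier ?C" for u
    using mem sq by (simp add: carrier_bar_cycles keys_tor_cycle bar_boundary_tor_cycle A.comm_group_axioms abc)
  have cyc_bc: "tor_cycle A a b \<in> carrier ?C" "tor_cycle A a c \<in> carrier ?C"
    using cyc by (simp_all add: abc)
  have T: "T u \<in> carrier (group_homology 3 A)" for u
    using cyc by (auto simp: T_def group_homology_def carrier_FactGroup)
  \<comment> \<open>\<open>T u\<close> is the image of \<open>T (0, 1, 0)\<close> under the endomorphism of rank at most two with
    \<open>a \<mapsto> a\<close> and \<open>b \<mapsto> e u\<close>, and \<open>r\<close> commutes with it.\<close>
  have det_T: "frag_eval (det_list e) z = 0" if "z \<in> r A (T u)" for u z
  proof -
    define f where "f = e \<circ> to_plane u \<circ> the_inv e"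
    have f: "f \<in> hom A A"
      unfolding f_def A_def by (intro transport_hom e to_plane_add)
    have fab: "f a = a" "f b = e u"
      by (cases u; simp add: f_def abc to_plane_def the_inv_f_f[OF e])+
    have "group_homology_map 3 A f (T (0, 1, 0)) = T u"
      using fab cyc[of "(0, 1, 0)", folded abc(2)] frag_map_tor_cycle[OF A.is_group A.is_group f, of a b]
      by (simp add: T_def group_homology_map_coset[OF A.is_monoid A.is_monoid f] flip: abc)
    then have "r A (T u) = ext_power_map 3 A f (r A (T (0, 1, 0)))"
      using r_nat[OF f T[of "(0, 1, 0)"]] by simp
    then show ?thesis
      using det_ext_power_map[OF e, folded A_def] hom_in_carrier[OF r_hom T] that
      unfolding f_def by blast
  qed
  \<comment> \<open>The element \<open>a \<and> b \<and> c\<close> of the exterior power.\<close>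
  define E where "E = ext_null 3 A #>\<^bsub>?F\<^esub> frag_of [a, b, c]"
  have tup: "[a, b, c] \<in> tuples 3 A"
    using mem by (simp add: tuples_3 abc)
  have E: "E \<in> carrier (ext_power 3 A)"
    using tup by (auto simp: E_def ext_power_def carrier_FactGroup)
  have iE: "ext_to_homology 3 A E = bar_boundaries 3 A #>\<^bsub>?C\<^esub> letter_product [a, b, c]"
    unfolding E_def by (rule ext_to_homology_coset[OF A.comm_group_axioms tup])
  have lp: "letter_product [a, b, c] \<in> carrier ?C"
    using hom_in_carrier[OF letter_product_hom[OF A.comm_group_axioms], of "frag_of [a, b, c]"] tup by simp
  define w where "w = pontryagin (halving A a) (frag_of [b, c]) -
    pontryagin (frag_of [a]) (frag_of [b, c, b \<otimes>\<^bsub>A\<^esub> c] - frag_of [c, c, b] - frag_of [\<one>\<^bsub>A\<^esub>, \<one>\<^bsub>A\<^esub>, b])"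
  have eq: "letter_product [a, b, c] + tor_cycle A a b + tor_cycle A a c =
      bar_boundary A w + tor_cycle A a (b \<otimes>\<^bsub>A\<^esub> c)"
    unfolding w_def abc
    by (subst letter_product_eq_tor_cycles) (simp_all add: mem sq A.comm_group_axioms)
  have "a \<in> carrier A" "b \<in> carrier A" "c \<in> carrier A"
    using mem by (simp_all add: abc)
  then have "Poly_Mapping.keys w \<subseteq> tuples (Suc 3) A"
    unfolding w_def halving_def
    by (auto simp: pontryagin_simps frag_extend_simps keys_frag_of tuples_def
        dest!: subsetD[OF keys_diff] subsetD[OF Poly_Mapping.keys_add])
  then have w: "bar_boundary A w \<in> bar_boundaries 3 A"
    by (simp add: bar_boundaries_def)
  let ?b = "(0, 1, 0)" and ?c = "(0, 0, 1)" and ?bc = "(0, 1, 1)"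
  have "ext_to_homology 3 A E <#>\<^bsub>?C\<^esub> T ?b <#>\<^bsub>?C\<^esub> T ?c =
      bar_boundaries 3 A #>\<^bsub>?C\<^esub> (bar_boundary A w + tor_cycle A a (b \<otimes>\<^bsub>A\<^esub> c))"
    using lp cyc_bc C.m_closed[OF lp cyc_bc(1)] eq by (simp add: iE T_def B.rcos_sum flip: abc)
  also have "\<dots> = T ?bc"
    using C.coset_mult_assoc[OF B.subset B.mem_carrier[OF w] cyc[of ?bc]]
      C.coset_join2[OF B.mem_carrier[OF w] B.subgroup_axioms w]
    by (simp add: T_def bc)
  finally have sum: "ext_to_homology 3 A E \<otimes>\<^bsub>group_homology 3 A\<^esub> T ?b \<otimes>\<^bsub>group_homology 3 A\<^esub> T ?c = T ?bc"
    by (simp add: group_homology_def)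
  have iE': "ext_to_homology 3 A E \<in> carrier (group_homology 3 A)"
    using lp by (auto simp: iE group_homology_def carrier_FactGroup)
  interpret H: comm_group "group_homology 3 A"
    by (rule group_homology_comm_group[OF A.is_monoid])
  have "E <#>\<^bsub>?F\<^esub> r A (T ?b) <#>\<^bsub>?F\<^esub> r A (T ?c) = r A (T ?bc)"
  proof -
    have "E \<otimes>\<^bsub>ext_power 3 A\<^esub> r A (T ?b) \<otimes>\<^bsub>ext_power 3 A\<^esub> r A (T ?c) = r A (T ?bc)"
      using iE' T r_retr[OF E] by (simp add: hom_mult[OF r_hom] flip: sum)
    then show ?thesis
      by (simp add: ext_power_def)
  qed
  \<comment> \<open>Elements of the exterior power are cosets; with representatives, the relation
    \<open>a \<and> b \<and> c + r(T b) + r(T c) = r(T (b + c))\<close> can be evaluated under the determinant.\<close>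
  moreover have "r A (T u) \<noteq> {}" for u
    using hom_in_carrier[OF r_hom T[of u]] subgroup.one_closed[OF ext_null_subgroup[OF A.is_monoid]]
    by (fastforce simp: ext_power_def carrier_FactGroup r_coset_def)
  then obtain z z' where z: "z \<in> r A (T ?b)" "z' \<in> r A (T ?c)"
    by blast
  moreover have "frag_of [a, b, c] \<in> E"
    using subgroup.one_closed[OF ext_null_subgroup[OF A.is_monoid, of 3]]
    by (auto simp: E_def r_coset_def intro!: bexI[of _ 0])
  ultimately have "frag_of [a, b, c] + z + z' \<in> r A (T ?bc)"
    by (auto simp: set_mult_def)
  then have "det_list e [a, b, c] = 0"
    using det_T[OF z(1)] det_T[OF z(2)] by (auto dest!: det_T simp: frag_eval_add)
  then show False
    using e by (simp add: det_list_def the_inv_f_f det3_def abc)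
qed

theorem corollary3p1:
  shows "\<not> (\<exists>r :: 'a::infinite monoid \<Rightarrow> ('a list \<Rightarrow>\<^sub>0 int) set \<Rightarrow> ('a list \<Rightarrow>\<^sub>0 int) set.
            natural_retraction (Ext_functor 3) (ext_to_homology 3) (Homology_functor 3) r) \<and>
         (\<forall>p :: 'a monoid \<Rightarrow> ('a list \<Rightarrow>\<^sub>0 int) set \<Rightarrow> 'a omega2.
            short_exact (Ext_functor 3) (ext_to_homology 3) (Homology_functor 3) p Omega2_functor \<longrightarrow>
            \<not> (\<exists>s. natural_section (Homology_functor 3) p Omega2_functor s))"
proof (intro conjI allI impI notI)
  show "\<exists>r :: 'a monoid \<Rightarrow> ('a list \<Rightarrow>\<^sub>0 int) set \<Rightarrow> ('a list \<Rightarrow>\<^sub>0 int) set.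
      natural_retraction (Ext_functor 3) (ext_to_homology 3) (Homology_functor 3) r \<Longrightarrow> False"
    using no_natural_retraction by blast
next
  fix p :: "'a monoid \<Rightarrow> ('a list \<Rightarrow>\<^sub>0 int) set \<Rightarrow> 'a omega2"
  assume ex: "short_exact (Ext_functor 3) (ext_to_homology 3) (Homology_functor 3) p Omega2_functor"
    and "\<exists>s. natural_section (Homology_functor 3) p Omega2_functor s"
  then obtain s where s: "natural_section (Homology_functor 3) p Omega2_functor s"
    by blast
  have "\<exists>r. natural_retraction (Ext_functor 3) (ext_to_homology 3) (Homology_functor 3 :: ('a, _) ab_functor) r"
  proof (rule natural_section_imp_natural_retraction[OF ex s])
    fix A B :: "'a monoid" and f
    assume A: "fg_ab A"
    interpret A: comm_group A
      using A by (simp add: fg_ab_def)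
    interpret E: comm_group "ext_power 3 A"
      by (rule ext_power_comm_group[OF A.is_monoid])
    interpret H: comm_group "group_homology 3 A"
      by (rule group_homology_comm_group[OF A.is_monoid])
    show "group (on_ob (Ext_functor 3) A)"
      by (simp add: Ext_functor_def E.is_group)
    show "group (on_ob (Homology_functor 3) A)"
      by (simp add: Homology_functor_def H.is_group)
    show "x \<otimes>\<^bsub>on_ob (Homology_functor 3) A\<^esub> y = y \<otimes>\<^bsub>on_ob (Homology_functor 3) A\<^esub> x"
      if "x \<in> carrier (on_ob (Homology_functor 3) A)" "y \<in> carrier (on_ob (Homology_functor 3) A)" for x y
      using that H.m_comm by (simp add: Homology_functor_def)
    assume B: "fg_ab B" and f: "f \<in> hom A B"
    interpret B: comm_group B
      using B by (simp add: fg_ab_def)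
    show "on_hom (Ext_functor 3) A B f \<in> hom (on_ob (Ext_functor 3) A) (on_ob (Ext_functor 3) B)"
      by (simp add: Ext_functor_def ext_power_map_hom[OF A.is_group B.is_group f])
    show "on_hom (Homology_functor 3) A B f \<in> hom (on_ob (Homology_functor 3) A) (on_ob (Homology_functor 3) B)"
      by (simp add: Homology_functor_def group_homology_map_hom[OF A.is_monoid B.is_monoid f])
  qed
  then show False
    using no_natural_retraction by blast
qed

end
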